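(* Let $X\subseteq 2^\omega$. Then $X$ is an $SR^{\mathcal N}$ set if and only if every Borel image of $X$ (in $2^\omega$) is $\mathcal N$-additive and every Borel image of $X$ into $\omega^\omega$ is bounded.
   Context: $2^\omega$ is the Cantor space with coordinatewise addition modulo $2$ and its standard product (Lebesgue) measure, and $\mathcal N$ is the $\sigma$-ideal of measure zero subsets of $2^\omega$. For $H\subseteq 2^\omega\times 2^\omega$ and $x\in 2^\omega$ put $(H)_x=\{y:\langle x,y\rangle\in H\}$. An $\mathcal N$-set is a Borel set $H\subseteq 2^\omega\times 2^\omega$ with $(H)_x\in\mathcal N$ for all $x\in 2^\omega$. A set $X\subseteq 2^\omega$ is an $SR^{\mathcal N}$ set if $\bigcup_{x\in X}(H)_x\in\mathcal N$ for every $\mathcal N$-set $H$. A set $Y\subseteq 2^\omega$ is $\mathcal N$-additive if $Y+F\in\mathcal N$ for every $F\in\mathcal N$. A Borel image of $X$ in $2^\omega$ (respectively, into $\omega^\omega$) is a set $f[X]$ where $f$ is a Borel function from $X$ to $2^\omega$ (respectively, to $\omega^\omega$); equivalently, $f$ may be taken to be Borel on all of $2^\omega$. A set $F\subseteq\omega^\omega$ is bounded if there is $g\in\omega^\omega$ such that for every $f\in F$, $f(n)\le g(n)$ for all but finitely many $n$. *)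

theory Defs
  imports "HOL-Probability.Probability"
begin

text \<open>
  The topologies on \<^typ>\<open>nat \<Rightarrow> bool\<close> (the Cantor space), \<^typ>\<open>nat \<Rightarrow> nat\<close> (the Baire
  space) and the square of the Cantor space are the product topologies of the library
  (\<^typ>\<open>bool\<close> and \<^typ>\<open>nat\<close> being discrete), and ``Borel'' refers to \<^const>\<open>borel\<close> for these.
\<close>

type_synonym cantor = "nat \<Rightarrow> bool"

definition cantor_add :: "cantor \<Rightarrow> cantor \<Rightarrow> cantor" (infixl \<open>\<oplus>\<^sub>2\<close> 65) where
  "x \<oplus>\<^sub>2 y = (\<lambda>n. x n \<noteq> y n)"  \<comment> \<open>addition modulo 2 of booleans is exclusive or\<close>

definition cantor_measure :: "cantor measure" where
  "cantor_measure = (\<Pi>\<^sub>M n\<in>UNIV. uniform_count_measure (UNIV :: bool set))"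

text \<open>
  The completion is taken because null sets need not be Borel: a set is null iff it is
  contained in a Borel set of measure zero.
\<close>

definition null_ideal :: "cantor set set" where
  "null_ideal = null_sets (completion cantor_measure)"

definition section_at :: "(cantor \<times> cantor) set \<Rightarrow> cantor \<Rightarrow> cantor set" where
  "section_at H x = {y. (x, y) \<in> H}"

definition N_set :: "(cantor \<times> cantor) set \<Rightarrow> bool" where
  "N_set H \<longleftrightarrow> H \<in> sets borel \<and> (\<forall>x. section_at H x \<in> null_ideal)"

definition SR_N :: "cantor set \<Rightarrow> bool" where
  "SR_N X \<longleftrightarrow> (\<forall>H. N_set H \<longrightarrow> (\<Union>x\<in>X. section_at H x) \<in> null_ideal)"

definition N_additive :: "cantor set \<Rightarrow> bool" where
  "N_additive Y \<longleftrightarrow> (\<forall>F\<in>null_ideal. {y \<oplus>\<^sub>2 z | y z. y \<in> Y \<and> z \<in> F} \<in> null_ideal)"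

text \<open>
  \<open>X\<close> carries the Borel structure induced from the whole space; since functions are total,
  \<open>f\<close> is arbitrary outside \<open>X\<close>.
\<close>

definition borel_image ::
    "'a::topological_space set \<Rightarrow> 'b::topological_space set \<Rightarrow> bool" where
  "borel_image X Y \<longleftrightarrow> (\<exists>f \<in> borel_measurable (restrict_space borel X). Y = f ` X)"

definition eventually_bounded :: "(nat \<Rightarrow> nat) set \<Rightarrow> bool" where
  "eventually_bounded F \<longleftrightarrow> (\<exists>g. \<forall>f\<in>F. \<forall>\<^sub>F n in sequentially. f n \<le> g n)"

end

theory Submission
  imports Defs
begin

text \<open>
  Both implications rest on one observation. Let \<open>A n k\<close> be open sets such that for fixed \<open>n\<close> the
  sets \<open>A n k\<close> are pairwise independent of measure \<open>2\<^sup>-\<^sup>n\<close>, and suppose that a null set contains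
  \<open>limsup\<^sub>n A n (f n)\<close> for every \<open>f\<close> of a family. A Baire category argument in the complement of a small
  open superset of that null set yields countably many sets \<open>K i\<close> of positive measure such that
  each \<open>f\<close> has an \<open>i\<close> for which \<open>K i\<close> almost avoids \<open>A n (f n)\<close> for all large \<open>n\<close>. By Chebyshev's
  inequality \<open>K i\<close> almost avoids at most \<open>2\<^sup>n / \<mu> (K i)\<close> of the sets \<open>A n k\<close>, so all \<open>f\<close> of the family
  are eventually captured by one slalom.

  If \<open>X\<close> is an \<open>SR\<close> set, then boundedness follows by taking for \<open>A n k\<close> cylinders on disjoint blocks
  of coordinates, and additivity follows by applying the definition to the sets \<open>f x + F\<close>.

  Conversely, given an \<open>\<N>\<close>-set \<open>H\<close>, a Borel choice of covers of the sections by open sets of small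
  measure gives a Borel \<open>f\<close> with \<open>H\<^sub>x \<subseteq> limsup\<^sub>n C (f x n)\<close>, where each \<open>C (f x n)\<close> is clopen of
  measure at most \<open>8\<^sup>-\<^sup>n\<close>. As \<open>f ` X\<close> is bounded by some \<open>g\<close>, its members can be encoded by elements
  of the Cantor space in such a way that translating a fixed null set by the code of \<open>f x\<close> produces
  \<open>limsup\<^sub>n A n (f x n)\<close> with \<open>A n k\<close>, \<open>k \<le> g n\<close>, as above. Additivity now bounds the number of
  clopen sets needed at stage \<open>n\<close> by \<open>(n + 1) 4\<^sup>n\<close>, and the limsup of their unions is null.
\<close>

section \<open>Measure and topology of the Cantor space\<close>

instance bool :: second_countable_topology
proof
  show "\<exists>B::bool set set. countable B \<and> open = generate_topology B"
  proof (intro exI conjI)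
    show "countable (UNIV :: bool set set)" by (rule countable_finite) simp
    show "open = generate_topology (UNIV :: bool set set)"
      by (simp add: fun_eq_iff Topological_Spaces.open_discrete generate_topology.Basis)
  qed
qed

lemma sets_cantor [measurable_cong]: "sets cantor_measure = sets borel"
proof -
  have "sets cantor_measure = sets (Pi\<^sub>M UNIV (\<lambda>_::nat. borel :: bool measure))"
    unfolding cantor_measure_def
  proof (rule sets_PiM_cong)
    have "A \<in> sets borel" for A :: "bool set" by (intro borel_open Topological_Spaces.open_discrete)
    then show "sets (uniform_count_measure UNIV) = sets (borel :: bool measure)"
      by (auto simp: sets_uniform_count_measure)
  qed simp
  then show ?thesis by (simp add: sets_PiM_equal_borel)
qed

lemma space_cantor [simp]: "space cantor_measure = UNIV"
  using sets_eq_imp_space_eq[OF sets_cantor] by simp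

interpretation cantor: prob_space cantor_measure
  unfolding cantor_measure_def
  by (intro prob_space_PiM prob_space_uniform_count_measure) auto

abbreviation mu :: "cantor set \<Rightarrow> real" where "mu \<equiv> measure cantor_measure"

definition pbox :: "nat set \<Rightarrow> cantor \<Rightarrow> cantor set" where
  "pbox B v = {y. \<forall>i\<in>B. y i = v i}"

lemma measurable_coord [measurable]: "Measurable.pred (borel :: cantor measure) (\<lambda>y. y i)"
proof -
  have "(\<lambda>y::cantor. y i) \<in> borel_measurable borel"
    by (intro borel_measurable_continuous_onI continuous_on_product_coordinates)
  then have "(\<lambda>y::cantor. y i) -` {True} \<inter> space borel \<in> sets borel"
    by (rule measurable_sets) (auto intro: borel_open Topological_Spaces.open_discrete)
  moreover have "(\<lambda>y::cantor. y i) -` {True} \<inter> space borel = {y. y i}" by auto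
  ultimately show ?thesis unfolding pred_def by simp
qed

lemma pbox_borel [measurable]: "pbox B v \<in> sets borel"
proof -
  have "pbox B v = {y. \<forall>i. i \<in> B \<longrightarrow> y i = v i}" by (auto simp: pbox_def)
  also have "\<dots> \<in> sets borel" by measurable
  finally show ?thesis .
qed

lemma mu_pbox: 
  assumes "finite B" shows "mu (pbox B v) = (1/2) ^ card B"
proof -
  interpret P: product_prob_space "\<lambda>_::nat. uniform_count_measure (UNIV :: bool set)" UNIV
    by (intro product_prob_spaceI prob_space_uniform_count_measure) auto
  have "pbox B v = prod_emb UNIV (\<lambda>_. uniform_count_measure UNIV) B (Pi\<^sub>E B (\<lambda>i. {v i}))"
    by (auto simp: pbox_def prod_emb_def space_uniform_count_measure PiE_def restrict_def extensional_def Pi_iff)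
  then have "emeasure cantor_measure (pbox B v) = (\<Prod>i\<in>B. emeasure (uniform_count_measure UNIV) {v i})"
    unfolding cantor_measure_def
    by (simp only:) (rule P.emeasure_PiM_emb, auto simp: assms)
  also have "\<dots> = (\<Prod>i\<in>B. ennreal (1/2))"
    by (intro prod.cong refl) (simp add: emeasure_uniform_count_measure)
  also have "\<dots> = ennreal ((1/2) ^ card B)"
    by (simp only: prod_constant ennreal_power)
  finally show ?thesis by (simp add: measure_def)
qed

lemma null_ideal_iff: "A \<in> null_ideal \<longleftrightarrow> (\<exists>N\<in>null_sets cantor_measure. A \<subseteq> N)"
  by (simp add: null_ideal_def null_sets_completion_iff2)

text \<open>The first Borel-Cantelli lemma.\<close>

lemma limsup_null:
  assumes "\<And>n. A n \<in> sets borel" "\<And>n. mu (A n) \<le> e n" "summable e"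
  shows "{y. \<exists>\<^sub>\<infinity>n. y \<in> A n} \<in> null_sets cantor_measure"
proof -
  have "limsup A = {y. \<exists>\<^sub>\<infinity>n. y \<in> A n}"
    by (auto simp: limsup_INF_SUP INFM_nat_le)
  moreover have "limsup A \<in> null_sets cantor_measure"
    using assms(1,2)
    by (intro borel_cantelli_limsup1 summable_comparison_test'[OF assms(3), of 0])
      (auto simp: sets_cantor cantor.emeasure_eq_measure)
  ultimately show ?thesis by simp
qed

section \<open>Cylinders of finite words\<close>

definition cyl :: "bool list \<Rightarrow> cantor set" where
  "cyl s = {y. \<forall>i<length s. y i = s ! i}"
definition prefix_of :: "cantor \<Rightarrow> nat \<Rightarrow> bool list" where
  "prefix_of y m = map y [0..<m]"

lemma cyl_pbox: "cyl s = pbox {..<length s} (\<lambda>i. s ! i)" by (auto simp: cyl_def pbox_def)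
lemma cyl_borel [measurable]: "cyl s \<in> sets borel" by (simp add: cyl_pbox)
lemma mu_cyl: "mu (cyl s) = (1/2) ^ length s" by (simp add: cyl_pbox mu_pbox)
lemma cyl_prefix: "cyl (prefix_of y m) = pbox {..<m} y" by (auto simp: cyl_def prefix_of_def pbox_def)
lemma mem_cyl_iff: "y \<in> cyl s \<longleftrightarrow> s = prefix_of y (length s)"
proof
  assume "y \<in> cyl s"
  then show "s = prefix_of y (length s)"
    by (intro nth_equalityI) (auto simp: cyl_def prefix_of_def)
next
  assume "s = prefix_of y (length s)"
  then have "s ! i = prefix_of y (length s) ! i" for i by simp
  then show "y \<in> cyl s" by (auto simp: cyl_def prefix_of_def)
qed

lemma open_pbox: assumes "finite B" shows "open (pbox B v)"
proof -
  have "open {y. y i = v i}" for i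
  proof -
    have "{y. y i = v i} = (\<lambda>y. y i) -` {v i}" by auto
    moreover have "open ((\<lambda>y::cantor. y i) -` {v i})"
      by (intro open_vimage Topological_Spaces.open_discrete continuous_on_product_coordinates)
    ultimately show ?thesis by simp
  qed
  moreover have "pbox B v = (\<Inter>i\<in>B. {y. y i = v i})" by (auto simp: pbox_def)
  ultimately show ?thesis using assms by (auto intro: open_INT)
qed

section \<open>Borel covers by open sections\<close>

text \<open>A basic open set of the product restricts only finitely many coordinates, and these lie
  below some \<open>m\<close>.\<close>

lemma open_contains_cyl:
  fixes S :: "cantor set"
  assumes "open S" "y \<in> S"
  obtains m where "cyl (prefix_of y m) \<subseteq> S"
proof -
  obtain X where X: "y \<in> Pi\<^sub>E UNIV X" "finite {i. X i \<noteq> UNIV}" "Pi\<^sub>E UNIV X \<subseteq> S"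
    using product_topology_open_contains_basis[OF assms(1)[unfolded open_fun_def] assms(2)]
    unfolding topspace_euclidean by (elim exE conjE)
  obtain m where m: "{i. X i \<noteq> UNIV} \<subseteq> {..<m}"
    using finite_nat_bounded[OF X(2)] by blast
  have "cyl (prefix_of y m) \<subseteq> Pi\<^sub>E UNIV X"
  proof
    fix z assume "z \<in> cyl (prefix_of y m)"
    then have z: "z i = y i" if "i < m" for i using that by (simp add: cyl_prefix pbox_def)
    have "z i \<in> X i" for i
    proof (cases "i < m")
      case True
      have "y i \<in> X i" using X(1) by (rule PiE_mem) simp
      then show ?thesis by (simp only: z[OF True])
    next
      case False
      then have "X i = UNIV" using m by blast
      then show ?thesis by simp
    qed
    then show "z \<in> Pi\<^sub>E UNIV X" by (intro PiE_I) simp_all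
  qed
  then have "cyl (prefix_of y m) \<subseteq> S" using X(3) by (rule order_trans)
  then show thesis by (rule that)
qed

lemma cyl_prefix_antimono: "m \<le> n \<Longrightarrow> cyl (prefix_of y n) \<subseteq> cyl (prefix_of y m)"
  unfolding cyl_prefix pbox_def by (intro Collect_mono ballI impI) (meson lessThan_iff order_less_le_trans)

lemma mem_cyl_prefix [simp]: "y \<in> cyl (prefix_of y m)" by (simp add: cyl_prefix pbox_def)

lemma length_prefix [simp]: "length (prefix_of y m) = m" by (simp add: prefix_of_def)

lemma prefix_pred_borel [measurable]: "{x. P (prefix_of x n)} \<in> sets borel"
proof -
  have "{x. P (prefix_of x n)} = (\<Union>t\<in>{t. P t \<and> length t = n}. cyl t)"
    by (auto simp: mem_cyl_iff)
  also have "\<dots> \<in> sets borel" by (intro sets.countable_UN' cyl_borel) auto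
  finally show ?thesis .
qed

text \<open>A code for a set with open sections: the section at \<open>x\<close> is the union of the
  \<open>cyl s\<close> with \<open>x \<in> A s\<close>. If all \<open>A s\<close> are Borel, this
  open set depends on \<open>x\<close> in a Borel way.\<close>

definition coded :: "(bool list \<Rightarrow> cantor set) \<Rightarrow> (cantor \<times> cantor) set" where
  "coded A = (\<Union>s. A s \<times> cyl s)"

text \<open>
  The induction over the Borel sets is carried out for \<open>H\<close> and its complement simultaneously, since
  outer approximability alone is not visibly preserved under complements.
\<close>

definition outer_approx :: "(cantor \<times> cantor) set \<Rightarrow> bool" where
  "outer_approx H \<longleftrightarrow> (\<forall>e>0. \<exists>A. (\<forall>s. A s \<in> sets borel) \<and> H \<subseteq> coded A \<and>
     (\<forall>x. mu (section_at (coded A) x) \<le> mu (section_at H x) + e))"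

lemma outer_approxE:
  assumes "outer_approx H" "e > 0"
  obtains A where "\<And>s. A s \<in> sets borel" "H \<subseteq> coded A"
    "\<And>x. mu (section_at (coded A) x) \<le> mu (section_at H x) + e"
  using assms(1)[unfolded outer_approx_def, rule_format, OF assms(2)] by auto

lemma outer_approx_seqE:
  fixes H :: "nat \<Rightarrow> (cantor \<times> cantor) set"
  assumes "\<And>n. outer_approx (H n)" "\<And>n. 0 < e n"
  obtains A where "\<And>n s. A n s \<in> sets borel" "\<And>n. H n \<subseteq> coded (A n)"
    "\<And>n x. mu (section_at (coded (A n)) x) \<le> mu (section_at (H n) x) + e n"
proof -
  have "\<forall>n. \<exists>A. (\<forall>s. A s \<in> sets borel) \<and> H n \<subseteq> coded A \<and>
     (\<forall>x. mu (section_at (coded A) x) \<le> mu (section_at (H n) x) + e n)"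
    using assms unfolding outer_approx_def by simp
  from choice[OF this] obtain A where "\<forall>n. (\<forall>s. A n s \<in> sets borel) \<and> H n \<subseteq> coded (A n) \<and>
     (\<forall>x. mu (section_at (coded (A n)) x) \<le> mu (section_at (H n) x) + e n)" ..
  then show thesis by (intro that[of A]) simp_all
qed

lemma sets_borel_prod: "sets (borel :: (cantor \<times> cantor) measure) = sets (borel \<Otimes>\<^sub>M borel)"
  by (rule arg_cong[where f = sets]) (rule borel_prod[symmetric])

lemma times_borel: "A \<in> sets borel \<Longrightarrow> B \<in> sets borel \<Longrightarrow> (A \<times> B :: (cantor \<times> cantor) set) \<in> sets borel"
  unfolding sets_borel_prod by (rule pair_measureI)

lemma coded_borel: "(\<And>s. A s \<in> sets borel) \<Longrightarrow> coded A \<in> sets borel"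
  unfolding coded_def by (intro sets.countable_UN'' times_borel cyl_borel) auto

lemma section_borel: "H \<in> sets borel \<Longrightarrow> section_at H x \<in> sets borel"
proof -
  have "section_at H x = Pair x -` H" by (auto simp: section_at_def)
  then show "H \<in> sets borel \<Longrightarrow> ?thesis" unfolding sets_borel_prod by (simp only: sets_Pair1)
qed

lemma section_sets [simp]: "H \<in> sets borel \<Longrightarrow> section_at H x \<in> sets cantor_measure"
  using section_borel sets_cantor by simp

lemma measurable_section:
  assumes "H \<in> sets borel" shows "(\<lambda>x. mu (section_at H x)) \<in> borel_measurable borel"
proof -
  have "(\<lambda>x. emeasure cantor_measure (Pair x -` H)) \<in> borel_measurable borel"
  proof (rule cantor.measurable_emeasure_Pair)
    show "H \<in> sets (borel \<Otimes>\<^sub>M cantor_measure)"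
      using assms unfolding sets_borel_prod sets_pair_measure_cong[OF refl sets_cantor] .
  qed
  moreover have "section_at H x = Pair x -` H" for x by (auto simp: section_at_def)
  ultimately show ?thesis unfolding measure_def by simp
qed

section \<open>Closure properties of outer approximability\<close>

lemma outer_approx_coded: "(\<And>s. A s \<in> sets borel) \<Longrightarrow> outer_approx (coded A)"
  unfolding outer_approx_def by (intro allI impI exI[of _ A]) auto

lemma section_mono: "H \<subseteq> K \<Longrightarrow> section_at H x \<subseteq> section_at K x" by (auto simp: section_at_def)

text \<open>Two cylinders with a common point \<open>y\<close> both contain the cylinder of the
  longer word.\<close>

lemma coded_Int:
  "coded A \<inter> coded B = coded (\<lambda>s. \<Union>(t, u)\<in>{(t, u). cyl s \<subseteq> cyl t \<inter> cyl u}. A t \<inter> B u)"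
proof (intro set_eqI iffI; clarify)
  fix x y assume "(x, y) \<in> coded A" "(x, y) \<in> coded B"
  then obtain t u where tu: "x \<in> A t" "y \<in> cyl t" "x \<in> B u" "y \<in> cyl u"
    by (auto simp: coded_def)
  define s where "s = prefix_of y (max (length t) (length u))"
  have "cyl s \<subseteq> cyl t" "cyl s \<subseteq> cyl u"
    using tu(2,4)[THEN mem_cyl_iff[THEN iffD1]]
      cyl_prefix_antimono[of "length t" "max (length t) (length u)" y]
      cyl_prefix_antimono[of "length u" "max (length t) (length u)" y]
    by (simp_all add: s_def)
  moreover have "y \<in> cyl s" by (simp add: s_def)
  ultimately have "(x, y) \<in> (\<Union>(t, u)\<in>{(t, u). cyl s \<subseteq> cyl t \<inter> cyl u}. A t \<inter> B u) \<times> cyl s"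
    using tu by auto
  then show "(x, y) \<in> coded (\<lambda>s. \<Union>(t, u)\<in>{(t, u). cyl s \<subseteq> cyl t \<inter> cyl u}. A t \<inter> B u)"
    unfolding coded_def by (rule UN_I[OF UNIV_I])
next
  fix x y assume "(x, y) \<in> coded (\<lambda>s. \<Union>(t, u)\<in>{(t, u). cyl s \<subseteq> cyl t \<inter> cyl u}. A t \<inter> B u)"
  then obtain s t u where "x \<in> A t" "x \<in> B u" "cyl s \<subseteq> cyl t" "cyl s \<subseteq> cyl u" "y \<in> cyl s"
    by (auto simp: coded_def)
  then show "(x, y) \<in> coded A \<inter> coded B" by (auto simp: coded_def)
qed

text \<open>At every \<open>x\<close> the excess of the intersected covers over
  \<open>H \<inter> K\<close> lies in the union of the two single excesses.\<close>

lemma outer_approx_Int: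
  assumes H: "outer_approx H" "H \<in> sets borel" and K: "outer_approx K" "K \<in> sets borel"
  shows "outer_approx (H \<inter> K)"
  unfolding outer_approx_def
proof (intro allI impI)
  fix e :: real assume "e > 0"
  then have e2: "e / 2 > 0" by simp
  obtain A where A: "\<And>s. A s \<in> sets borel" "H \<subseteq> coded A"
     "\<And>x. mu (section_at (coded A) x) \<le> mu (section_at H x) + e / 2"
    by (rule outer_approxE[OF H(1) e2]) (rule that)
  obtain B where B: "\<And>s. B s \<in> sets borel" "K \<subseteq> coded B"
     "\<And>x. mu (section_at (coded B) x) \<le> mu (section_at K x) + e / 2"
    by (rule outer_approxE[OF K(1) e2]) (rule that)
  define C where "C = (\<lambda>s. \<Union>(t, u)\<in>{(t, u). cyl s \<subseteq> cyl t \<inter> cyl u}. A t \<inter> B u)"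
  have C: "C s \<in> sets borel" for s
    unfolding C_def using A(1) B(1) by (intro sets.countable_UN') auto
  have eq: "coded C = coded A \<inter> coded B" by (simp add: C_def coded_Int)
  have [simp]: "coded A \<in> sets borel" "coded B \<in> sets borel" "coded C \<in> sets borel"
    using A(1) B(1) C coded_borel by blast+
  show "\<exists>A. (\<forall>s. A s \<in> sets borel) \<and> H \<inter> K \<subseteq> coded A \<and>
     (\<forall>x. mu (section_at (coded A) x) \<le> mu (section_at (H \<inter> K) x) + e)"
  proof (intro exI[of _ C] conjI allI)
    show "H \<inter> K \<subseteq> coded C" using A(2) B(2) eq by auto
    fix x
    let ?s = "\<lambda>H. section_at H x"
    note [simp] = H(2) K(2)
    have "?s (coded C) \<subseteq> ?s (H \<inter> K) \<union> ((?s (coded A) - ?s H) \<union> (?s (coded B) - ?s K))"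
      unfolding eq by (auto simp: section_at_def)
    then have "mu (?s (coded C)) \<le> mu (?s (H \<inter> K) \<union> ((?s (coded A) - ?s H) \<union> (?s (coded B) - ?s K)))"
      by (intro cantor.finite_measure_mono sets.Un sets.Diff section_sets) auto
    also have "\<dots> \<le> mu (?s (H \<inter> K)) + mu ((?s (coded A) - ?s H) \<union> (?s (coded B) - ?s K))"
      by (intro measure_Un_le sets.Un sets.Diff section_sets) auto
    also have "mu ((?s (coded A) - ?s H) \<union> (?s (coded B) - ?s K)) \<le> mu (?s (coded A) - ?s H) + mu (?s (coded B) - ?s K)"
      by (intro measure_Un_le sets.Diff section_sets) auto
    also have "mu (?s (coded A) - ?s H) = mu (?s (coded A)) - mu (?s H)"
      using A(2) by (intro cantor.finite_measure_Diff section_sets section_mono) auto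
    also have "mu (?s (coded B) - ?s K) = mu (?s (coded B)) - mu (?s K)"
      using B(2) by (intro cantor.finite_measure_Diff section_sets section_mono) auto
    finally show "mu (?s (coded C)) \<le> mu (?s (H \<inter> K)) + e" using A(3)[of x] B(3)[of x] by simp
  qed (fact C)
qed

text \<open>The excesses allowed for the single \<open>H n\<close> form a geometric series with sum
  \<open>e\<close>.\<close>

lemma outer_approx_UN:
  fixes H :: "nat \<Rightarrow> (cantor \<times> cantor) set"
  assumes H: "\<And>n. outer_approx (H n)" "\<And>n. H n \<in> sets borel"
  shows "outer_approx (\<Union>n. H n)"
  unfolding outer_approx_def
proof (intro allI impI)
  fix e :: real assume e: "e > 0"
  then have e': "0 < e * (1/2) ^ Suc n" for n by simp
  obtain A where A: "\<And>n s. A n s \<in> sets borel" "\<And>n. H n \<subseteq> coded (A n)"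
     "\<And>n x. mu (section_at (coded (A n)) x) \<le> mu (section_at (H n) x) + e * (1/2) ^ Suc n"
    by (rule outer_approx_seqE[OF H(1) e']) (rule that)
  define C where "C s = (\<Union>n. A n s)" for s
  have eq: "coded C = (\<Union>n. coded (A n))" by (auto simp: C_def coded_def)
  have C: "C s \<in> sets borel" for s unfolding C_def using A(1) by auto
  have [simp]: "coded (A n) \<in> sets borel" "coded C \<in> sets borel" for n
    using A(1) C coded_borel by blast+
  show "\<exists>A. (\<forall>s. A s \<in> sets borel) \<and> (\<Union>n. H n) \<subseteq> coded A \<and>
     (\<forall>x. mu (section_at (coded A) x) \<le> mu (section_at (\<Union>n. H n) x) + e)"
  proof (intro exI[of _ C] conjI allI)
    show "(\<Union>n. H n) \<subseteq> coded C" using A(2) eq by auto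
    fix x
    let ?s = "\<lambda>H. section_at H x"
    let ?D = "\<lambda>n. ?s (coded (A n)) - ?s (H n)"
    note [simp] = H(2)
    have UN: "(\<Union>n. H n) \<in> sets borel" by auto
    have D: "?D n \<in> sets cantor_measure" for n by auto
    have le: "mu (?D n) \<le> e * (1/2) ^ Suc n" for n
    proof -
      have "mu (?D n) = mu (?s (coded (A n))) - mu (?s (H n))"
        using A(2) by (intro cantor.finite_measure_Diff section_sets section_mono) auto
      then show ?thesis using A(3)[of n x] by simp
    qed
    have sums: "(\<lambda>n. e * (1/2) ^ Suc n) sums e"
      using sums_mult[OF power_half_series, of e] by simp
    have summ: "summable (\<lambda>n. mu (?D n))"
      by (rule summable_comparison_test'[OF sums_summable[OF sums], of 0]) (use le in auto)
    have "?s (coded C) \<subseteq> ?s (\<Union>n. H n) \<union> (\<Union>n. ?D n)"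
      unfolding eq by (auto simp: section_at_def)
    then have "mu (?s (coded C)) \<le> mu (?s (\<Union>n. H n) \<union> (\<Union>n. ?D n))"
      using UN D by (intro cantor.finite_measure_mono sets.Un section_sets) auto
    also have "\<dots> \<le> mu (?s (\<Union>n. H n)) + mu (\<Union>n. ?D n)"
      using UN D by (intro measure_Un_le section_sets) auto
    also have "mu (\<Union>n. ?D n) \<le> (\<Sum>n. mu (?D n))"
      using D by (intro cantor.finite_measure_subadditive_countably summ) auto
    also have "\<dots> \<le> (\<Sum>n. e * (1/2) ^ Suc n)"
      using le by (intro suminf_le summ sums_summable[OF sums]) auto
    also have "\<dots> = e" using sums by (simp add: sums_iff)
    finally show "mu (?s (coded C)) \<le> mu (?s (\<Union>n. H n)) + e" by simp
  qed (fact C)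
qed

text \<open>By continuity from above some \<open>H n\<close> has a section at \<open>x\<close>
  within \<open>e / 2\<close> of that of the intersection. The index depends on \<open>x\<close>,
  but the least one, \<open>N x\<close>, does so in a Borel way, and the cover of
  \<open>H (N x)\<close> is used at \<open>x\<close>.\<close>

lemma outer_approx_INT:
  fixes H :: "nat \<Rightarrow> (cantor \<times> cantor) set"
  assumes H: "\<And>n. outer_approx (H n)" "\<And>n. H n \<in> sets borel" and dec: "decseq H"
  shows "outer_approx (\<Inter>n. H n)"
  unfolding outer_approx_def
proof (intro allI impI)
  fix e :: real assume e: "e > 0"
  then have e': "0 < e / 2" by simp
  obtain A where A: "\<And>n s. A n s \<in> sets borel" "\<And>n. H n \<subseteq> coded (A n)"
     "\<And>n x. mu (section_at (coded (A n)) x) \<le> mu (section_at (H n) x) + e / 2"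
    by (rule outer_approx_seqE[OF H(1) e']) (rule that)
  let ?K = "\<Inter>n. H n"
  have K: "?K \<in> sets borel" using H(2) by auto
  define P where "P n x \<longleftrightarrow> mu (section_at (H n) x) < mu (section_at ?K x) + e / 2" for n x
  define N where "N x = (LEAST n. P n x)" for x
  have ex: "\<exists>n. P n x" for x
  proof -
    have "(\<lambda>n. mu (section_at (H n) x)) \<longlonglongrightarrow> mu (\<Inter>n. section_at (H n) x)"
      using H(2) dec section_mono
      by (intro cantor.finite_Lim_measure_decseq) (auto simp: decseq_def)
    moreover have "(\<Inter>n. section_at (H n) x) = section_at ?K x" by (auto simp: section_at_def)
    ultimately have "\<forall>\<^sub>F n in sequentially. mu (section_at (H n) x) < mu (section_at ?K x) + e / 2"
      using e by (intro order_tendstoD) auto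
    then show ?thesis unfolding P_def by (auto simp: eventually_sequentially)
  qed
  have PN: "P (N x) x" for x unfolding N_def using ex by (rule LeastI_ex)
  have [measurable]: "Measurable.pred borel (P n)" for n
    unfolding P_def using measurable_section[OF K] measurable_section[OF H(2)] by measurable
  have [measurable]: "N \<in> measurable borel (count_space UNIV)" unfolding N_def by measurable
  define C where "C s = {x. x \<in> A (N x) s}" for s
  have C: "C s \<in> sets borel" for s
  proof -
    have "C s = (\<Union>n. {x. N x = n} \<inter> A n s)" by (auto simp: C_def)
    moreover have "{x. N x = n} \<in> sets borel" for n by measurable
    ultimately show ?thesis using A(1) by auto
  qed
  have eq: "section_at (coded C) x = section_at (coded (A (N x))) x" for x
    by (auto simp: C_def coded_def section_at_def)
  show "\<exists>A. (\<forall>s. A s \<in> sets borel) \<and> ?K \<subseteq> coded A \<and>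
     (\<forall>x. mu (section_at (coded A) x) \<le> mu (section_at ?K x) + e)"
  proof (intro exI[of _ C] conjI allI)
    show "?K \<subseteq> coded C"
    proof clarify
      fix x y assume "(x, y) \<in> ?K"
      then have "(x, y) \<in> coded (A (N x))" using A(2) by blast
      then show "(x, y) \<in> coded C" using eq[of x] by (auto simp: section_at_def)
    qed
    show "mu (section_at (coded C) x) \<le> mu (section_at ?K x) + e" for x
      using A(3)[of "N x" x] PN[of x] unfolding P_def eq by simp
  qed (fact C)
qed

lemma outer_approx_open:
  assumes "open S" shows "outer_approx S"
proof -
  \<comment> \<open>An open set is itself coded. Testing a box of equal side lengths makes
    \<open>A s\<close> depend on finitely many coordinates of \<open>x\<close>, hence Borel.\<close>
  define A where "A s = {x. cyl (prefix_of x (length s)) \<times> cyl s \<subseteq> S}" for s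
  have "coded A = S"
  proof (intro set_eqI iffI; clarify)
    fix x y assume "(x, y) \<in> S"
    then obtain U V where UV: "open U" "open V" "x \<in> U" "y \<in> V" "U \<times> V \<subseteq> S"
      using assms by (auto elim: open_prod_elim)
    obtain m where m: "cyl (prefix_of x m) \<subseteq> U" using open_contains_cyl UV by metis
    obtain n where n: "cyl (prefix_of y n) \<subseteq> V" using open_contains_cyl UV by metis
    have "cyl (prefix_of x (max m n)) \<subseteq> U" "cyl (prefix_of y (max m n)) \<subseteq> V"
      using m n cyl_prefix_antimono[of m "max m n" x] cyl_prefix_antimono[of n "max m n" y] by auto
    then have "x \<in> A (prefix_of y (max m n))"
      using UV(5) unfolding A_def by auto
    then show "(x, y) \<in> coded A" using mem_cyl_prefix unfolding coded_def by blast
  next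
    fix x y assume "(x, y) \<in> coded A"
    then obtain s where "cyl (prefix_of x (length s)) \<times> cyl s \<subseteq> S" "y \<in> cyl s"
      by (auto simp: coded_def A_def)
    then show "(x, y) \<in> S" using mem_cyl_prefix by blast
  qed
  moreover have "A s \<in> sets borel" for s unfolding A_def by measurable
  ultimately show ?thesis using outer_approx_coded by metis
qed

text \<open>A closed set is the decreasing intersection of the clopen sets of those pairs whose
  \<open>n\<close>-th box is not contained in \<open>S\<close>; each of these is coded.\<close>

lemma outer_approx_closed:
  assumes "open S" shows "outer_approx (- S)"
proof -
  define A where "A n s = {x. length s = n \<and> \<not> (cyl (prefix_of x n) \<times> cyl s \<subseteq> S)}" for n s
  have A: "A n s \<in> sets borel" for n s
    unfolding A_def by (rule prefix_pred_borel[where P = "\<lambda>t. length s = n \<and> \<not> (cyl t \<times> cyl s \<subseteq> S)"])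
  have mem: "(x, y) \<in> coded (A n) \<longleftrightarrow> \<not> (cyl (prefix_of x n) \<times> cyl (prefix_of y n) \<subseteq> S)" for x y n
  proof
    assume "(x, y) \<in> coded (A n)"
    then obtain s where s: "x \<in> A n s" "y \<in> cyl s" by (auto simp: coded_def)
    then have "length s = n" by (simp add: A_def)
    with s(2) have "s = prefix_of y n" by (metis mem_cyl_iff)
    with s(1) show "\<not> (cyl (prefix_of x n) \<times> cyl (prefix_of y n) \<subseteq> S)" by (simp add: A_def)
  next
    assume "\<not> (cyl (prefix_of x n) \<times> cyl (prefix_of y n) \<subseteq> S)"
    then have "x \<in> A n (prefix_of y n)" by (simp add: A_def)
    then show "(x, y) \<in> coded (A n)" using mem_cyl_prefix unfolding coded_def by blast
  qed
  have "(x, y) \<in> S \<longleftrightarrow> (\<exists>n. (x, y) \<notin> coded (A n))" for x y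
  proof
    assume "(x, y) \<in> S"
    then obtain U V where UV: "open U" "open V" "x \<in> U" "y \<in> V" "U \<times> V \<subseteq> S"
      using assms by (auto elim: open_prod_elim)
    obtain m where m: "cyl (prefix_of x m) \<subseteq> U" using open_contains_cyl UV by metis
    obtain n where n: "cyl (prefix_of y n) \<subseteq> V" using open_contains_cyl UV by metis
    have "cyl (prefix_of x (max m n)) \<subseteq> U" "cyl (prefix_of y (max m n)) \<subseteq> V"
      using m n cyl_prefix_antimono[of m "max m n" x] cyl_prefix_antimono[of n "max m n" y] by auto
    then have "cyl (prefix_of x (max m n)) \<times> cyl (prefix_of y (max m n)) \<subseteq> S"
      using UV(5) by auto
    then show "\<exists>n. (x, y) \<notin> coded (A n)" unfolding mem by blast
  next
    assume "\<exists>n. (x, y) \<notin> coded (A n)"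
    then show "(x, y) \<in> S" unfolding mem using mem_cyl_prefix by blast
  qed
  then have "- S = (\<Inter>n. coded (A n))" by auto
  moreover have "decseq (\<lambda>n. coded (A n))"
  proof (rule antimonoI, clarify)
    fix m n :: nat and x y assume "m \<le> n" "(x, y) \<in> coded (A n)"
    then show "(x, y) \<in> coded (A m)"
      unfolding mem using cyl_prefix_antimono[of m n x] cyl_prefix_antimono[of m n y] by blast
  qed
  ultimately show ?thesis
    using outer_approx_INT[of "\<lambda>n. coded (A n)"] outer_approx_coded coded_borel A by simp
qed

lemma outer_approx_borel:
  assumes "H \<in> sets borel" shows "outer_approx H"
proof -
  have "H \<in> sigma_sets UNIV {S. open S}" using assms by (simp add: borel_def)
  then have "H \<in> sets borel \<and> outer_approx H \<and> outer_approx (- H)"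
  proof induction
    case (Basic S)
    then show ?case using outer_approx_open outer_approx_closed by simp
  next
    case Empty
    show ?case using outer_approx_open[of "{}"] outer_approx_closed[of "{}"] by simp
  next
    case (Compl a)
    then show ?case by (auto simp: Compl_eq_Diff_UNIV[symmetric])
  next
    case (Union a)
    \<comment> \<open>Finite intersections make the sequence decreasing, as
      \<open>outer_approx_INT\<close> demands.\<close>
    have fin: "outer_approx (\<Inter>i\<le>n. - a i) \<and> (\<Inter>i\<le>n. - a i) \<in> sets borel" for n :: nat
    proof (induction n)
      case 0 then show ?case using Union.IH[of 0] by auto
    next
      case (Suc n)
      have "(\<Inter>i\<le>Suc n. - a i) = (\<Inter>i\<le>n. - a i) \<inter> - a (Suc n)" by (auto simp: atMost_Suc)
      then show ?case using outer_approx_Int Suc Union.IH[of "Suc n"] by (metis sets.Int borel_comp)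
    qed
    have "- (\<Union>i. a i) = (\<Inter>n. \<Inter>i\<le>n. - a i)" by auto
    moreover have "outer_approx (\<Inter>n. \<Inter>i\<le>n. - a i)"
      using fin by (intro outer_approx_INT) (auto simp: antimono_def)
    ultimately show ?case using Union.IH outer_approx_UN[of a] by auto
  qed
  then show ?thesis by simp
qed

section \<open>Sets of positive measure avoiding a limsup\<close>

text \<open>
  Chebyshev's inequality for the number of \<open>k \<in> S\<close> with \<open>w \<in> A k\<close>, which vanishes almost everywhere on \<open>K\<close>.
\<close>

lemma (in prob_space) pairwise_independent_cover:
  fixes d :: real
  assumes "finite S" and A: "\<And>k. k \<in> S \<Longrightarrow> A k \<in> events" and K: "K \<in> events"
    and d: "\<And>k. k \<in> S \<Longrightarrow> prob (A k) = d"
    and d2: "\<And>k l. k \<in> S \<Longrightarrow> l \<in> S \<Longrightarrow> k \<noteq> l \<Longrightarrow> prob (A k \<inter> A l) = d\<^sup>2"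
    and null: "\<And>k. k \<in> S \<Longrightarrow> prob (K \<inter> A k) = 0"
  shows "prob K * (card S * d) \<le> 1"
proof -
  define m where "m = card S * d"
  define X :: "'a \<Rightarrow> real" where "X w = (\<Sum>k\<in>S. indicator (A k) w)" for w
  have ind: "integrable M (indicator B :: 'a \<Rightarrow> real)" if "B \<in> events" for B
    using that by (simp add: emeasure_eq_measure)
  have XX: "(X w - m)\<^sup>2 = (\<Sum>k\<in>S. \<Sum>l\<in>S. indicator (A k \<inter> A l) w) - 2 * m * X w + m\<^sup>2" for w
    by (simp add: X_def power2_diff power2_eq_square sum_product indicator_inter_arith algebra_simps)
  have i1: "integrable M (\<lambda>w. \<Sum>k\<in>S. \<Sum>l\<in>S. indicator (A k \<inter> A l) w :: real)"
    by (intro Bochner_Integration.integrable_sum ind sets.Int A)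
  have i2: "integrable M X"
    unfolding X_def by (intro Bochner_Integration.integrable_sum ind A)
  have i3: "integrable M (\<lambda>w. (X w - m)\<^sup>2)"
    unfolding XX using i1 i2 by simp
  have e2: "expectation X = m"
    unfolding X_def m_def using A ind d by (simp add: Bochner_Integration.integral_sum)
  have "expectation (\<lambda>w. \<Sum>k\<in>S. \<Sum>l\<in>S. indicator (A k \<inter> A l) w) = (\<Sum>k\<in>S. \<Sum>l\<in>S. prob (A k \<inter> A l))"
    using A ind by (simp add: Bochner_Integration.integral_sum Bochner_Integration.integrable_sum sets.Int)
  also have "\<dots> = (\<Sum>k\<in>S. d + real (card S - 1) * d\<^sup>2)"
  proof (intro sum.cong refl)
    fix k assume k: "k \<in> S"
    have "(\<Sum>l\<in>S. prob (A k \<inter> A l)) = prob (A k) + (\<Sum>l\<in>S - {k}. prob (A k \<inter> A l))"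
      using k assms(1) by (subst sum.remove[of _ k]) auto
    also have "(\<Sum>l\<in>S - {k}. prob (A k \<inter> A l)) = (\<Sum>l\<in>S - {k}. d\<^sup>2)"
      using k by (intro sum.cong d2) auto
    finally show "(\<Sum>l\<in>S. prob (A k \<inter> A l)) = d + real (card S - 1) * d\<^sup>2"
      using k assms(1) d by simp
  qed
  also have "\<dots> = card S * d + card S * real (card S - 1) * d\<^sup>2"
    by (simp add: algebra_simps)
  finally have e1: "expectation (\<lambda>w. \<Sum>k\<in>S. \<Sum>l\<in>S. indicator (A k \<inter> A l) w) = m + card S * real (card S - 1) * d\<^sup>2"
    by (simp add: m_def)
  have "expectation (\<lambda>w. (X w - m)\<^sup>2) = m + card S * real (card S - 1) * d\<^sup>2 - 2 * m * m + m\<^sup>2"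
    unfolding XX using i1 i2 e1 e2 by (simp add: prob_space)
  \<comment> \<open>The off-diagonal pairs contribute at most \<open>m\<^sup>2\<close>, which is
    cancelled by the last two terms; the diagonal leaves \<open>m\<close>.\<close>
  also have "\<dots> \<le> m"
  proof -
    have "real (card S * (card S - 1)) \<le> real (card S * card S)"
      by (intro of_nat_mono mult_le_mono) auto
    then have "real (card S * (card S - 1)) * d\<^sup>2 \<le> real (card S * card S) * d\<^sup>2"
      by (intro mult_right_mono) auto
    also have "\<dots> = m * m" by (simp add: m_def power2_eq_square)
    finally show ?thesis by (simp add: power2_eq_square)
  qed
  finally have up: "expectation (\<lambda>w. (X w - m)\<^sup>2) \<le> m" .
  \<comment> \<open>Off the null pieces \<open>K \<inter> A k\<close> the count \<open>X\<close> is
    0 on \<open>K\<close>, so the squared deviation equals \<open>m\<^sup>2\<close> there.\<close>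
  define K' where "K' = K - (\<Union>k\<in>S. K \<inter> A k)"
  have K': "K' \<in> events" unfolding K'_def using A K assms(1) by auto
  have "prob K' = prob K"
    unfolding K'_def using A K assms(1) null
    by (intro measure_Diff_null_set null_sets.finite_UN) (auto simp: null_sets_def emeasure_eq_measure)
  moreover have "expectation (\<lambda>w. m\<^sup>2 * indicator K' w) \<le> expectation (\<lambda>w. (X w - m)\<^sup>2)"
  proof (rule integral_mono)
    show "integrable M (\<lambda>w. m\<^sup>2 * indicator K' w)" using ind[OF K'] by simp
    fix w show "m\<^sup>2 * indicator K' w \<le> (X w - m)\<^sup>2"
    proof (cases "w \<in> K'")
      case True
      then have "X w = 0" unfolding X_def K'_def by (intro sum.neutral) (auto simp: indicator_def)
      then show ?thesis using True by simp
    qed simp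
  qed (rule i3)
  ultimately have "m * (m * prob K) \<le> m" using up K' by (simp add: power2_eq_square mult.assoc)
  moreover have "0 \<le> m"
  proof (cases "S = {}")
    case False
    then obtain k where "k \<in> S" by auto
    then have "0 \<le> d" using d[of k] measure_nonneg[of M "A k"] by simp
    then show ?thesis by (simp add: m_def)
  qed (simp add: m_def)
  ultimately have "m * prob K \<le> 1"
    by (cases "m = 0") (auto simp: mult_le_cancel_left1)
  then show ?thesis by (simp add: m_def mult.commute)
qed

text \<open>Outer regularity, read off from the result on sections: all sections of
  \<open>UNIV \<times> N'\<close> are \<open>N'\<close>, so the cover at a single point
  serves.\<close>

lemma null_outer_cover:
  assumes "N \<in> null_ideal" "e > 0"
  obtains T where "N \<subseteq> (\<Union>s\<in>T. cyl s)" "mu (\<Union>s\<in>T. cyl s) \<le> e"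
proof -
  obtain N' where N': "N' \<in> null_sets cantor_measure" "N \<subseteq> N'" using assms(1) null_ideal_iff by auto
  have "(UNIV :: cantor set) \<times> N' \<in> sets borel" using N'(1) sets_cantor by (intro times_borel) (auto simp: null_sets_def)
  then have "outer_approx ((UNIV :: cantor set) \<times> N')" by (rule outer_approx_borel)
  then obtain A where A: "(UNIV :: cantor set) \<times> N' \<subseteq> coded A"
     "\<And>x. mu (section_at (coded A) x) \<le> mu (section_at ((UNIV :: cantor set) \<times> N') x) + e"
    by (rule outer_approxE[OF _ assms(2)]) (rule that)
  define x0 :: cantor where "x0 = (\<lambda>_. False)"
  have s1: "section_at (coded A) x0 = (\<Union>s\<in>{s. x0 \<in> A s}. cyl s)"
    by (auto simp: section_at_def coded_def)
  have s2: "section_at ((UNIV :: cantor set) \<times> N') x0 = N'" by (auto simp: section_at_def)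
  have "mu N' = 0" using N'(1) by (simp add: null_sets_def measure_def)
  show thesis
  proof (rule that[of "{s. x0 \<in> A s}"])
    show "N \<subseteq> (\<Union>s\<in>{s. x0 \<in> A s}. cyl s)" using N'(2) A(1) section_mono[OF A(1), of x0] s1 s2 by simp
    show "mu (\<Union>s\<in>{s. x0 \<in> A s}. cyl s) \<le> e" using A(2)[of x0] s1 s2 \<open>mu N' = 0\<close> by simp
  qed
qed

section \<open>Nested cylinders and the category argument\<close>

lemma cyl_nonempty: "\<exists>y. y \<in> cyl s"
  by (rule exI[of _ "\<lambda>i. s ! i"]) (simp add: cyl_def)

lemma cyl_nth: "y \<in> cyl s \<Longrightarrow> i < length s \<Longrightarrow> y i = s ! i"
  unfolding cyl_def by blast

text \<open>The point is the diagonal \<open>s (Suc j) ! j\<close>; nesting makes any two of the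
  words agree wherever both are defined.\<close>

lemma nested_cyl_point:
  assumes len: "\<And>i. i < length (s (Suc i))" and nest: "\<And>i. cyl (s (Suc i)) \<subseteq> cyl (s i)"
  shows "\<exists>y. \<forall>i. y \<in> cyl (s i)"
proof -
  have nest': "cyl (s j) \<subseteq> cyl (s i)" if "i \<le> j" for i j
    using nest that by (rule lift_Suc_antimono_le[of "\<lambda>i. cyl (s i)"])
  define y where "y j = s (Suc j) ! j" for j
  have "y j = s i ! j" if j: "j < length (s i)" for i j
  proof -
    obtain z where z: "z \<in> cyl (s (max i (Suc j)))" using cyl_nonempty by blast
    have "z \<in> cyl (s i)" "z \<in> cyl (s (Suc j))"
      using z nest'[of i "max i (Suc j)"] nest'[of "Suc j" "max i (Suc j)"] by auto
    then show ?thesis unfolding y_def using cyl_nth j len[of j] by metis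
  qed
  then have "y \<in> cyl (s i)" for i unfolding cyl_def by blast
  then show ?thesis by blast
qed

text \<open>The lower bound \<open>n\<close> on the lengths is what makes the words grow in the
  category argument.\<close>

lemma open_cyl_union:
  assumes "open B"
  shows "B = (\<Union>t\<in>{t. n \<le> length t \<and> cyl t \<subseteq> B}. cyl t)"
proof
  show "B \<subseteq> (\<Union>t\<in>{t. n \<le> length t \<and> cyl t \<subseteq> B}. cyl t)"
  proof
    fix y assume "y \<in> B"
    then obtain m where "cyl (prefix_of y m) \<subseteq> B" using open_contains_cyl[OF assms] by blast
    then have "cyl (prefix_of y (max m n)) \<subseteq> B" using cyl_prefix_antimono[of m "max m n" y] by auto
    then have "prefix_of y (max m n) \<in> {t. n \<le> length t \<and> cyl t \<subseteq> B}" by simp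
    then show "y \<in> (\<Union>t\<in>{t. n \<le> length t \<and> cyl t \<subseteq> B}. cyl t)" using mem_cyl_prefix by blast
  qed
qed blast

lemma open_cyl: "open (cyl s)" unfolding cyl_pbox by (rule open_pbox) simp

text \<open>
  If the conclusion failed for \<open>f\<close>, one could choose a decreasing sequence of cylinders, each meeting
  the complement \<open>K0\<close> of a small open \<open>U \<supseteq> N\<close> in positive measure and infinitely many contained in
  some \<open>A n (f n)\<close>; their common point would lie in \<open>N\<close> but not in \<open>U\<close>.
\<close>

lemma limsup_in_null_separation:
  fixes A :: "nat \<Rightarrow> nat \<Rightarrow> cantor set" and Fam :: "(nat \<Rightarrow> nat) set"
  assumes op: "\<And>n k. open (A n k)" and N: "N \<in> null_ideal"
    and sub: "\<And>f. f \<in> Fam \<Longrightarrow> {y. \<exists>\<^sub>\<infinity>n. y \<in> A n (f n)} \<subseteq> N"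
  shows "\<exists>K :: nat \<Rightarrow> cantor set. (\<forall>i. K i \<in> sets borel \<and> 0 < mu (K i)) \<and>
    (\<forall>f\<in>Fam. \<exists>i. \<forall>\<^sub>\<infinity>n. mu (K i \<inter> A n (f n)) = 0)"
proof -
  obtain T where T: "N \<subseteq> (\<Union>s\<in>T. cyl s)" "mu (\<Union>s\<in>T. cyl s) \<le> 1/2"
    using null_outer_cover[OF N, of "1/2"] by auto
  define U where "U = (\<Union>s\<in>T. cyl s)"
  have U: "U \<in> sets borel" unfolding U_def by (intro sets.countable_UN' cyl_borel) auto
  define K0 where "K0 = - U"
  have K0: "K0 \<in> sets borel" using U unfolding K0_def by auto
  have "mu K0 = 1 - mu U"
    using cantor.prob_compl[of U] U sets_cantor by (simp add: K0_def Compl_eq_Diff_UNIV)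
  then have posK0: "0 < mu K0" using T(2) U_def by simp
  \<comment> \<open>These words stand for the relatively open parts of \<open>K0\<close> of positive
    measure, among which the category argument moves.\<close>
  define Pos where "Pos = {s. 0 < mu (K0 \<inter> cyl s)}"
  have "cyl [] = UNIV" by (simp add: cyl_def)
  then have nil: "[] \<in> Pos" using posK0 by (simp add: Pos_def)
  \<comment> \<open>An enumeration of \<open>Pos\<close>; words outside \<open>Pos\<close> are
    replaced by the root \<open>[]\<close>, which belongs to it.\<close>
  define s :: "nat \<Rightarrow> bool list" where "s i = (if from_nat i \<in> Pos then from_nat i else [])" for i
  have s: "s i \<in> Pos" for i using nil by (simp add: s_def)
  show ?thesis
  proof (intro exI[of _ "\<lambda>i. K0 \<inter> cyl (s i)"] conjI allI ballI)
    show "K0 \<inter> cyl (s i) \<in> sets borel" for i using K0 by auto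
    show "0 < mu (K0 \<inter> cyl (s i))" for i using s[of i] by (simp add: Pos_def)
    fix f assume f: "f \<in> Fam"
    have "\<exists>p\<in>Pos. \<forall>\<^sub>\<infinity>n. mu (K0 \<inter> cyl p \<inter> A n (f n)) = 0"
    proof (rule ccontr)
      assume neg: "\<not> ?thesis"
      have inf: "\<exists>\<^sub>\<infinity>n. mu (K0 \<inter> cyl p \<inter> A n (f n)) \<noteq> 0" if "p \<in> Pos" for p
      proof -
        have "\<not> (\<forall>\<^sub>\<infinity>n. mu (K0 \<inter> cyl p \<inter> A n (f n)) = 0)" using neg that by blast
        then show ?thesis unfolding frequently_def not_not .
      qed
      define Q where "Q i p t \<longleftrightarrow> i < length t \<and> cyl t \<subseteq> cyl p \<and> (\<exists>n\<ge>i. cyl t \<subseteq> A n (f n))" for i :: nat and p t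
      have step: "\<exists>t. t \<in> Pos \<and> Q i p t" if p: "p \<in> Pos" for p i
      proof -
        obtain n where n: "n \<ge> i" "mu (K0 \<inter> cyl p \<inter> A n (f n)) \<noteq> 0"
          using inf[OF p] unfolding INFM_nat_le by blast
        let ?B = "cyl p \<inter> A n (f n)"
        let ?T = "{t. Suc i \<le> length t \<and> cyl t \<subseteq> ?B}"
        have "open ?B" using op open_cyl by auto
        then have B: "?B = (\<Union>t\<in>?T. cyl t)" by (rule open_cyl_union)
        \<comment> \<open>The traces of countably many cylinders cannot all be null, as their union
          is not.\<close>
        have "\<exists>t\<in>?T. mu (K0 \<inter> cyl t) \<noteq> 0"
        proof (rule ccontr)
          assume "\<not> ?thesis"
          then have "(\<Union>t\<in>?T. K0 \<inter> cyl t) \<in> null_sets cantor_measure"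
            using K0 sets_cantor
            by (intro null_sets_UN') (auto simp: null_sets_def cantor.emeasure_eq_measure)
          moreover have "(\<Union>t\<in>?T. K0 \<inter> cyl t) = K0 \<inter> cyl p \<inter> A n (f n)"
            using B by blast
          ultimately show False using n(2) by (simp add: null_sets_def measure_def)
        qed
        then obtain t where t: "t \<in> ?T" "mu (K0 \<inter> cyl t) \<noteq> 0" by blast
        then have "t \<in> Pos" unfolding Pos_def using zero_less_measure_iff by blast
        moreover have "Q i p t" unfolding Q_def using t(1) n(1) by auto
        ultimately show ?thesis by blast
      qed
      obtain p where p: "\<And>i. p i \<in> Pos" "\<And>i. Q i (p i) (p (Suc i))"
      proof -
        have "\<exists>p. \<forall>i. p i \<in> Pos \<and> Q i (p i) (p (Suc i))"
          by (rule dependent_nat_choice) (use nil step in blast)+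
        then show thesis using that by blast
      qed
      obtain y where y: "\<And>i. y \<in> cyl (p i)"
        using nested_cyl_point[of p] p(2) unfolding Q_def by blast
      have "\<exists>n\<ge>i. y \<in> A n (f n)" for i
        using p(2)[of i] y[of "Suc i"] unfolding Q_def by blast
      then have "\<exists>\<^sub>\<infinity>n. y \<in> A n (f n)" unfolding INFM_nat_le by blast
      then have "y \<in> N" using sub[OF f] by blast
      then obtain u where u: "u \<in> T" "y \<in> cyl u" using T(1) by blast
      \<comment> \<open>At this stage the word is longer than \<open>u\<close> and its cylinder
        shares \<open>y\<close> with \<open>cyl u\<close>, so it lies in \<open>U\<close> and misses
        \<open>K0\<close>.\<close>
      have "length u < length (p (Suc (length u)))" using p(2)[of "length u"] by (simp add: Q_def)
      then have "cyl (p (Suc (length u))) \<subseteq> cyl u"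
        using y[of "Suc (length u)"] u(2) cyl_prefix_antimono[of "length u" "length (p (Suc (length u)))" y]
        by (metis mem_cyl_iff less_imp_le)
      then have "cyl (p (Suc (length u))) \<subseteq> U" using u(1) U_def by blast
      then have "K0 \<inter> cyl (p (Suc (length u))) = {}" by (auto simp: K0_def)
      then show False using p(1)[of "Suc (length u)"] by (simp add: Pos_def)
    qed
    then obtain p where p: "p \<in> Pos" "\<forall>\<^sub>\<infinity>n. mu (K0 \<inter> cyl p \<inter> A n (f n)) = 0" by blast
    then have "s (to_nat p) = p" by (simp add: s_def)
    then show "\<exists>i. \<forall>\<^sub>\<infinity>n. mu (K0 \<inter> cyl (s i) \<inter> A n (f n)) = 0" using p(2) by metis
  qed
qed

section \<open>SR sets\<close>

lemma borel_measurable_bool_iff: "(f :: 'a \<Rightarrow> bool) \<in> borel_measurable M \<longleftrightarrow> Measurable.pred M f"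
proof -
  have "A \<in> sets borel" for A :: "bool set" by (intro borel_open Topological_Spaces.open_discrete)
  then have "sets (borel :: bool measure) = sets (count_space UNIV)" by auto
  then show ?thesis using measurable_cong_sets[OF refl] by blast
qed

lemma measurable_borel_coord:
  fixes f :: "'a \<Rightarrow> nat \<Rightarrow> 'c :: second_countable_topology"
  assumes "f \<in> borel_measurable M"
  shows "(\<lambda>x. f x i) \<in> borel_measurable M"
proof -
  have "(\<lambda>g :: nat \<Rightarrow> 'c. g i) \<in> borel_measurable borel"
    by (intro borel_measurable_continuous_onI continuous_on_product_coordinates)
  with assms show ?thesis by (rule measurable_compose)
qed

lemma cantor_add_measurable:
  assumes f: "f \<in> borel_measurable M" and g: "g \<in> borel_measurable M"
  shows "(\<lambda>p. f p \<oplus>\<^sub>2 g p) \<in> borel_measurable M"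
proof (rule measurable_coordinatewise_then_product)
  fix i
  have "Measurable.pred M (\<lambda>p. f p i)" "Measurable.pred M (\<lambda>p. g p i)"
    using measurable_borel_coord[OF f] measurable_borel_coord[OF g] by (simp_all only: borel_measurable_bool_iff)
  then have "Measurable.pred M (\<lambda>p. f p i \<noteq> g p i)" by measurable
  then show "(\<lambda>p. (f p \<oplus>\<^sub>2 g p) i) \<in> borel_measurable M"
    unfolding cantor_add_def by (simp only: borel_measurable_bool_iff)
qed

section \<open>Translation invariance of the measure\<close>

lemma translate_measurable: "(\<lambda>y. c \<oplus>\<^sub>2 y) \<in> measurable cantor_measure cantor_measure"
proof -
  have "(\<lambda>y. c \<oplus>\<^sub>2 y) \<in> borel_measurable borel"
    by (rule cantor_add_measurable) (simp_all add: measurable_const measurable_ident)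
  then show ?thesis using measurable_cong_sets[OF sets_cantor sets_cantor] by blast
qed

text \<open>A product measure is determined by finite-dimensional boxes, and in each coordinate the
  translation permutes \<open>bool\<close>, preserving the uniform measure.\<close>

lemma distr_cantor_add: "distr cantor_measure cantor_measure (\<lambda>y. c \<oplus>\<^sub>2 y) = cantor_measure"
proof -
  let ?C = "uniform_count_measure (UNIV :: bool set)"
  interpret P: product_prob_space "\<lambda>_::nat. ?C" UNIV
    by (intro product_prob_spaceI prob_space_uniform_count_measure) auto
  note m = translate_measurable[of c]
  show ?thesis
  proof (rule measure_eqI_PiM_infinite[symmetric, where M = "\<lambda>_. ?C" and I = UNIV])
    show "finite_measure cantor_measure" by unfold_locales
    fix A :: "nat \<Rightarrow> bool set" and J :: "nat set" assume J: "finite J"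
    let ?B = "\<lambda>i. {b. (c i \<noteq> b) \<in> A i}"
    have "emeasure (distr cantor_measure cantor_measure (\<lambda>y. c \<oplus>\<^sub>2 y)) (prod_emb UNIV (\<lambda>_. ?C) J (Pi\<^sub>E J A))
      = emeasure cantor_measure ((\<lambda>y. c \<oplus>\<^sub>2 y) -` (prod_emb UNIV (\<lambda>_. ?C) J (Pi\<^sub>E J A)) \<inter> space cantor_measure)"
      by (rule emeasure_distr[OF m]) (simp add: cantor_measure_def J sets_PiM_I_finite sets_uniform_count_measure)
    also have "(\<lambda>y. c \<oplus>\<^sub>2 y) -` (prod_emb UNIV (\<lambda>_. ?C) J (Pi\<^sub>E J A)) \<inter> space cantor_measure = prod_emb UNIV (\<lambda>_. ?C) J (Pi\<^sub>E J ?B)"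
      by (auto simp: prod_emb_def space_uniform_count_measure PiE_def Pi_def cantor_add_def)
    also have "emeasure cantor_measure \<dots> = (\<Prod>i\<in>J. emeasure ?C (?B i))"
      unfolding cantor_measure_def using J by (intro P.emeasure_PiM_emb) (auto simp: sets_uniform_count_measure)
    also have "\<dots> = (\<Prod>i\<in>J. emeasure ?C (A i))"
    proof (intro prod.cong refl)
      fix i
      have "bij_betw (\<lambda>b. c i \<noteq> b) (?B i) (A i)"
        by (cases "c i"; rule bij_betw_byWitness[where f' = "\<lambda>b. c i \<noteq> b"]) auto
      then show "emeasure ?C (?B i) = emeasure ?C (A i)"
        by (simp add: emeasure_uniform_count_measure bij_betw_same_card)
    qed
    also have "\<dots> = emeasure cantor_measure (prod_emb UNIV (\<lambda>_. ?C) J (Pi\<^sub>E J A))"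
      unfolding cantor_measure_def using J by (intro P.emeasure_PiM_emb[symmetric]) (auto simp: sets_uniform_count_measure)
    finally show "emeasure cantor_measure (prod_emb UNIV (\<lambda>_. ?C) J (Pi\<^sub>E J A)) =
      emeasure (distr cantor_measure cantor_measure (\<lambda>y. c \<oplus>\<^sub>2 y)) (prod_emb UNIV (\<lambda>_. ?C) J (Pi\<^sub>E J A))" ..
  qed (simp_all add: cantor_measure_def)
qed

lemma null_translate:
  assumes "N \<in> null_sets cantor_measure"
  shows "{y. c \<oplus>\<^sub>2 y \<in> N} \<in> null_sets cantor_measure"
proof -
  note m = translate_measurable[of c]
  have N: "N \<in> sets cantor_measure" using assms by (simp add: null_sets_def)
  have "{y. c \<oplus>\<^sub>2 y \<in> N} = (\<lambda>y. c \<oplus>\<^sub>2 y) -` N \<inter> space cantor_measure" by auto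
  moreover have "emeasure cantor_measure ((\<lambda>y. c \<oplus>\<^sub>2 y) -` N \<inter> space cantor_measure) = emeasure cantor_measure N"
    by (subst (3) distr_cantor_add[of c, symmetric], rule emeasure_distr[OF m N, symmetric])
  moreover have "(\<lambda>y. c \<oplus>\<^sub>2 y) -` N \<inter> space cantor_measure \<in> sets cantor_measure"
    using m N by (rule measurable_sets)
  ultimately show ?thesis using assms by (simp add: null_sets_def)
qed

text \<open>Each set \<open>{x \<in> X. f x i = v}\<close> is the trace of a Borel set
  \<open>B i v\<close>. Off \<open>X\<close> these may overlap or leave gaps, so
  \<open>g x i\<close> takes the first suitable \<open>v\<close> in an enumeration; on
  \<open>X\<close> exactly one is suitable.\<close>

lemma borel_extension:
  fixes f :: "cantor \<Rightarrow> nat \<Rightarrow> 'c :: {countable, discrete_topology, second_countable_topology}"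
  assumes f: "f \<in> borel_measurable (restrict_space borel X)"
  obtains g where "g \<in> borel_measurable borel" "\<And>x. x \<in> X \<Longrightarrow> g x = f x"
proof -
  have "\<exists>B. B \<in> sets borel \<and> {x \<in> X. f x i = v} = X \<inter> B" for i v
  proof -
    have "(\<lambda>x. f x i) -` {v} \<inter> space (restrict_space borel X) \<in> sets (restrict_space borel X)"
      using measurable_borel_coord[OF f]
      by (rule measurable_sets) (intro borel_open Topological_Spaces.open_discrete)
    moreover have "(\<lambda>x. f x i) -` {v} \<inter> space (restrict_space borel X) = {x \<in> X. f x i = v}"
      by (auto simp: space_restrict_space)
    ultimately show ?thesis unfolding sets_restrict_space image_iff by auto
  qed
  then have "\<forall>i. \<exists>b. \<forall>v. b v \<in> sets borel \<and> {x \<in> X. f x i = v} = X \<inter> b v" by (intro allI choice)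
  from choice[OF this] obtain B where
    B': "\<forall>i v. B i v \<in> sets borel \<and> {x \<in> X. f x i = v} = X \<inter> B i v" ..
  have B: "B i v \<in> sets borel" "{x \<in> X. f x i = v} = X \<inter> B i v" for i v using B' by simp_all
  define L where "L i x = (LEAST n. x \<in> B i (from_nat n))" for i x
  define g :: "cantor \<Rightarrow> nat \<Rightarrow> 'c" where "g x i = from_nat (L i x)" for x i
  note [measurable] = B(1)
  have L [measurable]: "L i \<in> measurable borel (count_space UNIV)" for i unfolding L_def by measurable
  have g: "g \<in> borel_measurable borel"
  proof (rule measurable_coordinatewise_then_product)
    fix i
    have "from_nat \<in> measurable (count_space UNIV) (borel :: 'c measure)" by simp
    with L show "(\<lambda>x. g x i) \<in> borel_measurable borel" unfolding g_def by (rule measurable_compose)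
  qed
  have "g x = f x" if x: "x \<in> X" for x
  proof
    fix i
    have *: "x \<in> B i v \<longleftrightarrow> f x i = v" for v using B(2)[of i v] x by blast
    have "x \<in> B i (from_nat (L i x))"
      unfolding L_def by (rule LeastI[of _ "to_nat (f x i)"]) (simp add: *)
    then show "g x i = f x i" using * by (simp add: g_def)
  qed
  with g show thesis by (rule that)
qed

lemma SR_N_imp_additive:
  assumes X: "SR_N X" and Y: "borel_image X Y" shows "N_additive Y"
  unfolding N_additive_def
proof
  fix F assume "F \<in> null_ideal"
  then obtain N where N: "N \<in> null_sets cantor_measure" "F \<subseteq> N" using null_ideal_iff by auto
  obtain f where f: "f \<in> borel_measurable (restrict_space borel X)" "Y = f ` X"
    using Y unfolding borel_image_def by auto
  obtain g where g: "g \<in> borel_measurable borel" "\<And>x. x \<in> X \<Longrightarrow> g x = f x"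
    using borel_extension[OF f(1)] by metis
  \<comment> \<open>Addition is its own inverse, so the section at \<open>x\<close> is the translate
    of \<open>N\<close> by \<open>g x\<close>. The extension \<open>g\<close> makes \<open>H\<close>
    Borel in the whole square.\<close>
  define H where "H = {(x, y). g x \<oplus>\<^sub>2 y \<in> N}"
  have sec: "section_at H x = {y. g x \<oplus>\<^sub>2 y \<in> N}" for x by (simp add: H_def section_at_def)
  have "N_set H"
    unfolding N_set_def
  proof
    have "(\<lambda>p. g (fst p) \<oplus>\<^sub>2 snd p) \<in> borel_measurable (borel :: (cantor \<times> cantor) measure)"
    proof (rule cantor_add_measurable)
      show "(\<lambda>p. g (fst p)) \<in> borel_measurable (borel :: (cantor \<times> cantor) measure)"
        using borel_measurable_continuous_onI[OF continuous_on_fst[OF continuous_on_id]] g(1) by (rule measurable_compose)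
      show "snd \<in> borel_measurable (borel :: (cantor \<times> cantor) measure)"
        by (rule borel_measurable_continuous_onI[OF continuous_on_snd[OF continuous_on_id]])
    qed
    then have "(\<lambda>p. g (fst p) \<oplus>\<^sub>2 snd p) -` N \<inter> space borel \<in> sets (borel :: (cantor \<times> cantor) measure)"
      by (rule measurable_sets) (use N(1) sets_cantor in \<open>auto simp: null_sets_def\<close>)
    moreover have "(\<lambda>p. g (fst p) \<oplus>\<^sub>2 snd p) -` N \<inter> space borel = H" by (auto simp: H_def)
    ultimately show "H \<in> sets borel" by simp
    show "\<forall>x. section_at H x \<in> null_ideal"
      unfolding sec using null_translate[OF N(1)] null_ideal_iff by blast
  qed
  then have "(\<Union>x\<in>X. section_at H x) \<in> null_ideal" using X by (simp add: SR_N_def)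
  moreover have "{y \<oplus>\<^sub>2 z |y z. y \<in> Y \<and> z \<in> F} \<subseteq> (\<Union>x\<in>X. section_at H x)"
  proof safe
    fix y z assume "y \<in> Y" "z \<in> F"
    then obtain x where x: "x \<in> X" "y = f x" using f(2) by auto
    have "g x \<oplus>\<^sub>2 (y \<oplus>\<^sub>2 z) = z" using x g(2) by (auto simp: cantor_add_def fun_eq_iff)
    then have "y \<oplus>\<^sub>2 z \<in> section_at H x" using N(2) \<open>z \<in> F\<close> sec by auto
    then show "y \<oplus>\<^sub>2 z \<in> (\<Union>x\<in>X. section_at H x)" using x(1) by blast
  qed
  ultimately show "{y \<oplus>\<^sub>2 z |y z. y \<in> Y \<and> z \<in> F} \<in> null_ideal"
    unfolding null_ideal_iff by (meson order_trans)
qed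

section \<open>Independent blocks and boundedness\<close>

definition block :: "nat \<Rightarrow> nat \<Rightarrow> nat set" where
  "block n k = (\<lambda>i. to_nat (n, k, i)) ` {..<n}"

text \<open>Injectivity of \<open>to_nat\<close> on triples separates the blocks; disjoint blocks
  will give independent sets.\<close>

lemma block: "finite (block n k)" "card (block n k) = n" "k \<noteq> l \<Longrightarrow> block n k \<inter> block n l = {}"
proof -
  show "card (block n k) = n" unfolding block_def by (subst card_image) (auto intro: inj_onI)
qed (auto simp: block_def)

definition ones :: "nat set \<Rightarrow> cantor set" where "ones B = pbox B (\<lambda>_. True)"

lemma ones_Int: "ones B \<inter> ones C = ones (B \<union> C)" by (auto simp: ones_def pbox_def)

text \<open>The SR property puts the sets limsup \<open>A n (h n)\<close>, \<open>h \<in> F\<close>,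
  into one null set. Hence each \<open>h\<close> is eventually captured by one of countably many
  sequences of finite sets \<open>S i n\<close>.\<close>

lemma SR_N_imp_bounded:
  assumes X: "SR_N X" and F: "borel_image X F" shows "eventually_bounded F"
proof -
  obtain f :: "cantor \<Rightarrow> nat \<Rightarrow> nat" where f: "f \<in> borel_measurable (restrict_space borel X)" "F = f ` X"
    using F unfolding borel_image_def by auto
  obtain g where g: "g \<in> borel_measurable borel" "\<And>x. x \<in> X \<Longrightarrow> g x = f x"
    using borel_extension[OF f(1)] by metis
  define A where "A n k = ones (block n k)" for n k
  have A [measurable]: "A n k \<in> sets borel" for n k by (simp add: A_def ones_def)
  have opA: "open (A n k)" for n k using open_pbox block(1) by (simp add: A_def ones_def)
  have muA: "mu (A n k) = (1/2)^n" for n k using mu_pbox block by (simp add: A_def ones_def)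
  have muAA: "mu (A n k \<inter> A n l) = ((1/2)^n)\<^sup>2" if "k \<noteq> l" for n k l
  proof -
    have "card (block n k \<union> block n l) = n + n" using block that by (simp add: card_Un_disjoint)
    then show ?thesis
      using mu_pbox block(1) unfolding A_def ones_Int by (simp add: ones_def power_add power2_eq_square)
  qed
  define H where "H = {(x, y). \<exists>\<^sub>\<infinity>n. y \<in> A n (g x n)}"
  have sec: "section_at H x = {y. \<exists>\<^sub>\<infinity>n. y \<in> A n (g x n)}" for x by (simp add: H_def section_at_def)
  have "N_set H"
    unfolding N_set_def
  proof
    have gm: "{x. g x n = k} \<in> sets borel" for n k
    proof -
      have "(\<lambda>x. g x n) -` {k} \<inter> space borel \<in> sets borel"
        using measurable_borel_coord[OF g(1)]
        by (rule measurable_sets) (intro borel_open Topological_Spaces.open_discrete)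
      moreover have "(\<lambda>x. g x n) -` {k} \<inter> space borel = {x. g x n = k}" by auto
      ultimately show ?thesis by simp
    qed
    \<comment> \<open>Splitting according to the value of \<open>g x n\<close> leaves
      rectangles.\<close>
    have "H = (\<Inter>m. \<Union>n\<in>{m..}. \<Union>k. {x. g x n = k} \<times> A n k)"
      by (auto simp: H_def INFM_nat_le Bex_def)
    also have "\<dots> \<in> sets borel"
    proof -
      have "(\<Union>k. {x. g x n = k} \<times> A n k) \<in> sets borel" for n
        using gm A by (intro sets.countable_UN'' times_borel) auto
      then show ?thesis by (intro sets.countable_INT'' sets.countable_UN') auto
    qed
    finally show "H \<in> sets borel" .
    have "{y. \<exists>\<^sub>\<infinity>n. y \<in> A n (g x n)} \<in> null_sets cantor_measure" for x
      by (rule limsup_null[where e = "\<lambda>n. (1/2)^n"]) (auto simp: muA)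
    then show "\<forall>x. section_at H x \<in> null_ideal" unfolding sec null_ideal_iff by blast
  qed
  then have null: "(\<Union>x\<in>X. section_at H x) \<in> null_ideal" using X by (simp add: SR_N_def)
  have sub: "{y. \<exists>\<^sub>\<infinity>n. y \<in> A n (h n)} \<subseteq> (\<Union>x\<in>X. section_at H x)" if "h \<in> F" for h
  proof -
    obtain x where x: "x \<in> X" "h = g x" using \<open>h \<in> F\<close> f(2) g(2) by auto
    then show ?thesis using sec by blast
  qed
  obtain K :: "nat \<Rightarrow> cantor set" where
    K': "(\<forall>i. K i \<in> sets borel \<and> 0 < mu (K i)) \<and>
    (\<forall>h\<in>F. \<exists>i. \<forall>\<^sub>\<infinity>n. mu (K i \<inter> A n (h n)) = 0)"
    using limsup_in_null_separation[where A = A and Fam = F, OF opA null sub] ..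
  have K: "\<And>i. K i \<in> sets borel" "\<And>i. 0 < mu (K i)"
    "\<And>h. h \<in> F \<Longrightarrow> \<exists>i. \<forall>\<^sub>\<infinity>n. mu (K i \<inter> A n (h n)) = 0"
    using K' by blast+
  define S where "S i n = {k. mu (K i \<inter> A n k) = 0}" for i n
  have finS: "finite (S i n)" for i n
  proof (rule ccontr)
    assume inf: "infinite (S i n)"
    have pos: "0 < mu (K i) * (1/2)^n" using K(2)[of i] by simp
    \<comment> \<open>More sets than Chebyshev's bound \<open>2 ^ n / mu (K i)\<close>
      permits.\<close>
    then obtain c :: nat where c: "1 < real c * (mu (K i) * (1/2)^n)" using reals_Archimedean3 by blast
    obtain B where B: "B \<subseteq> S i n" "finite B" "card B = c" using infinite_arbitrarily_large[OF inf] by blast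
    have "mu (K i) * (card B * (1/2)^n) \<le> 1"
      using B K(1) muAA A sets_cantor
      by (intro cantor.pairwise_independent_cover[of B "A n"]) (auto simp: muA S_def)
    then show False using c B(3) by (simp add: mult_ac)
  qed
  \<comment> \<open>Using all \<open>i \<le> n\<close> at stage \<open>n\<close> lets one function
    dominate for every \<open>i\<close> from stage \<open>i\<close> on; \<open>0\<close> keeps the
    argument of \<open>Max\<close> nonempty.\<close>
  define b where "b n = Max (insert 0 (\<Union>i\<le>n. S i n))" for n
  show ?thesis
    unfolding eventually_bounded_def
  proof (intro exI[of _ b] ballI)
    fix h assume "h \<in> F"
    then obtain i m where im: "\<And>n. m \<le> n \<Longrightarrow> mu (K i \<inter> A n (h n)) = 0"
      using K(3) unfolding MOST_nat_le by blast
    show "\<forall>\<^sub>F n in sequentially. h n \<le> b n"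
      unfolding eventually_sequentially
    proof (intro exI[of _ "max i m"] allI impI)
      fix n assume n: "max i m \<le> n"
      then have "h n \<in> (\<Union>i\<le>n. S i n)" using im[of n] unfolding S_def by auto
      then show "h n \<le> b n" unfolding b_def using finS by (intro Max_ge) auto
    qed
  qed
qed

section \<open>Additive sets and slaloms\<close>

text \<open>
  The coordinates of the \<open>n\<close>-th block consist of an address, a word of length \<open>g n + 1\<close>, and a table
  assigning an \<open>n\<close>-bit entry to every possible address. The sets used are of the form ``the entries
  at the positions \<open>R a\<close> consist of ones, where \<open>a\<close> is the address''. Flipping different bits of the
  address leads to different, hence independent, entries, while it is just a translation.
\<close>

definition acoord :: "nat \<Rightarrow> nat \<Rightarrow> nat" where
  "acoord n j = to_nat (Inl (n, j) :: (nat \<times> nat) + (nat \<times> bool list \<times> nat))"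

definition tcoord :: "nat \<Rightarrow> bool list \<Rightarrow> nat \<Rightarrow> nat" where
  "tcoord n a i = to_nat (Inr (n, a, i) :: (nat \<times> nat) + (nat \<times> bool list \<times> nat))"

lemma coord_inj [simp]:
  "acoord n j = acoord m k \<longleftrightarrow> n = m \<and> j = k"
  "tcoord n a i = tcoord m b j \<longleftrightarrow> n = m \<and> a = b \<and> i = j"
  "acoord n j \<noteq> tcoord m b i" "tcoord m b i \<noteq> acoord n j"
  by (simp_all add: acoord_def tcoord_def)

definition addr :: "nat \<Rightarrow> nat \<Rightarrow> cantor \<Rightarrow> bool list" where
  "addr L n y = map (\<lambda>j. y (acoord n j)) [0..<L]"

definition hit :: "nat \<Rightarrow> nat \<Rightarrow> (bool list \<Rightarrow> bool list set) \<Rightarrow> cantor set" where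
  "hit L n R = {y. \<forall>a\<in>R (addr L n y). \<forall>i<n. y (tcoord n a i)}"

definition hit_support :: "nat \<Rightarrow> nat \<Rightarrow> bool list set \<Rightarrow> nat set" where
  "hit_support L n Q = acoord n ` {..<L} \<union> (\<lambda>(a, i). tcoord n a i) ` (Q \<times> {..<n})"

text \<open>The implication gives \<open>True\<close> at every coordinate that is not an address bit
  of block \<open>n\<close>, as required in the table.\<close>

definition hit_values :: "nat \<Rightarrow> bool list \<Rightarrow> cantor" where
  "hit_values n a c \<longleftrightarrow> (\<forall>j. c = acoord n j \<longrightarrow> a ! j)"

lemma length_addr [simp]: "length (addr L n y) = L" by (simp add: addr_def)

lemma addr_eq_iff: "length a = L \<Longrightarrow> addr L n y = a \<longleftrightarrow> (\<forall>j<L. y (acoord n j) = a ! j)"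
  by (subst list_eq_iff_nth_eq) (simp add: addr_def)

lemma hit_values [simp]: "hit_values n a (acoord n j) = a ! j" "hit_values n a (tcoord n b i)"
  by (simp_all add: hit_values_def)

lemma hit_pbox_iff:
  assumes "length a = L"
  shows "y \<in> pbox (hit_support L n Q) (hit_values n a) \<longleftrightarrow> addr L n y = a \<and> (\<forall>b\<in>Q. \<forall>i<n. y (tcoord n b i))"
proof -
  have "y \<in> pbox (hit_support L n Q) (hit_values n a) \<longleftrightarrow>
     (\<forall>j<L. y (acoord n j) = hit_values n a (acoord n j)) \<and> (\<forall>b\<in>Q. \<forall>i<n. y (tcoord n b i) = hit_values n a (tcoord n b i))"
    unfolding pbox_def hit_support_def by (simp only: mem_Collect_eq ball_Un ball_simps) auto
  then show ?thesis unfolding addr_eq_iff[OF assms] by (simp only: hit_values simp_thms)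
qed

text \<open>Once the address is fixed, the condition becomes a box.\<close>

lemma hit_eq: "hit L n R = (\<Union>a\<in>{a. length a = L}. pbox (hit_support L n (R a)) (hit_values n a))"
proof (rule set_eqI)
  fix y
  have "y \<in> (\<Union>a\<in>{a. length a = L}. pbox (hit_support L n (R a)) (hit_values n a)) \<longleftrightarrow>
    (\<exists>a. length a = L \<and> addr L n y = a \<and> (\<forall>b\<in>R a. \<forall>i<n. y (tcoord n b i)))"
    using hit_pbox_iff by blast
  also have "\<dots> \<longleftrightarrow> y \<in> hit L n R" by (auto simp: hit_def)
  finally show "y \<in> hit L n R \<longleftrightarrow> y \<in> (\<Union>a\<in>{a. length a = L}. pbox (hit_support L n (R a)) (hit_values n a))" ..
qed

lemma hit_borel: "hit L n R \<in> sets borel"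
  unfolding hit_eq by (intro sets.countable_UN' pbox_borel) auto

lemma card_hit_support:
  assumes "finite Q" shows "finite (hit_support L n Q)" "card (hit_support L n Q) = L + card Q * n"
proof -
  show fin: "finite (hit_support L n Q)" using assms by (simp add: hit_support_def)
  have "card (acoord n ` {..<L}) = L" by (subst card_image) (auto intro: inj_onI)
  moreover have "card ((\<lambda>(a, i). tcoord n a i) ` (Q \<times> {..<n})) = card Q * n"
    by (subst card_image) (auto intro: inj_onI simp: card_cartesian_product)
  moreover have "acoord n ` {..<L} \<inter> (\<lambda>(a, i). tcoord n a i) ` (Q \<times> {..<n}) = {}" by auto
  ultimately show "card (hit_support L n Q) = L + card Q * n"
    unfolding hit_support_def using assms by (subst card_Un_disjoint) auto
qed

lemma lists_length_bool: "finite {a :: bool list. length a = L}" "card {a :: bool list. length a = L} = 2 ^ L"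
  using finite_lists_length_eq[of "UNIV :: bool set" L] card_lists_length_eq[of "UNIV :: bool set" L] by simp_all

lemma open_hit:
  assumes "\<And>a. finite (R a)" shows "open (hit L n R)"
  unfolding hit_eq using assms by (intro open_UN ballI open_pbox card_hit_support)

text \<open>There are \<open>2 ^ L\<close> addresses, and each box fixes \<open>L + r * n\<close>
  coordinates. The boxes are disjoint because a point determines its address.\<close>

lemma mu_hit:
  assumes R: "\<And>a. finite (R a)" "\<And>a. length a = L \<Longrightarrow> card (R a) = r"
  shows "mu (hit L n R) = (1/2) ^ (r * n)"
proof -
  let ?P = "\<lambda>a. pbox (hit_support L n (R a)) (hit_values n a)"
  have "mu (hit L n R) = (\<Sum>a\<in>{a. length a = L}. mu (?P a))"
    unfolding hit_eq
  proof (rule cantor.finite_measure_finite_Union)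
    show "disjoint_family_on ?P {a. length a = L}"
      unfolding disjoint_family_on_def
    proof (intro ballI impI)
      fix a b :: "bool list" assume ab: "a \<in> {a. length a = L}" "b \<in> {a. length a = L}" "a \<noteq> b"
      then have "length a = L" "length b = L" by simp_all
      note iff = hit_pbox_iff[OF this(1)] hit_pbox_iff[OF this(2)]
      show "?P a \<inter> ?P b = {}" using ab(3) by (auto simp: iff)
    qed
    show "?P ` {a. length a = L} \<subseteq> cantor.events" using pbox_borel unfolding sets_cantor by blast
  qed (rule lists_length_bool)
  also have "\<dots> = (\<Sum>a\<in>{a :: bool list. length a = L}. (1/2) ^ (L + r * n))"
  proof (rule sum.cong[OF refl])
    fix a :: "bool list" assume "a \<in> {a. length a = L}"
    then have "card (R a) = r" using R(2) by blast
    then show "mu (?P a) = (1/2) ^ (L + r * n)"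
      by (simp only: mu_pbox[OF card_hit_support(1)[OF R(1)]] card_hit_support(2)[OF R(1)])
  qed
  also have "\<dots> = (1/2) ^ (r * n)"
    by (simp add: lists_length_bool power_add power_one_over del: One_nat_def)
  finally show ?thesis .
qed

section \<open>Flipping address bits by translation\<close>

definition flip :: "nat \<Rightarrow> bool list \<Rightarrow> bool list" where
  "flip k a = a[k := \<not> a ! k]"

lemma flip_neq: "k < length a \<Longrightarrow> l < length a \<Longrightarrow> k \<noteq> l \<Longrightarrow> flip k a \<noteq> flip l a"
  unfolding flip_def by (metis nth_list_update_eq nth_list_update_neq)

text \<open>
  If \<open>f n > g n\<close>, then the \<open>n\<close>-th block of the code is zero, in accordance with \<open>flip (f n) a = a\<close>
  for words \<open>a\<close> of length \<open>g n + 1\<close>.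
\<close>

definition encode :: "(nat \<Rightarrow> nat) \<Rightarrow> (nat \<Rightarrow> nat) \<Rightarrow> cantor" where
  "encode g f c \<longleftrightarrow> (\<exists>n. f n \<le> g n \<and> c = acoord n (f n))"

lemma encode_simps [simp]:
  "encode g f (acoord n j) \<longleftrightarrow> f n \<le> g n \<and> j = f n" "\<not> encode g f (tcoord n a i)"
  by (auto simp: encode_def)

lemma addr_encode: "addr (Suc (g n)) n (encode g f \<oplus>\<^sub>2 y) = flip (f n) (addr (Suc (g n)) n y)"
proof (rule nth_equalityI)
  fix j assume "j < length (addr (Suc (g n)) n (encode g f \<oplus>\<^sub>2 y))"
  then have j: "j < Suc (g n)" by simp
  then show "addr (Suc (g n)) n (encode g f \<oplus>\<^sub>2 y) ! j = flip (f n) (addr (Suc (g n)) n y) ! j"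
    by (cases "j = f n") (auto simp: addr_def flip_def cantor_add_def simp del: upt_Suc)
qed (simp add: flip_def)

text \<open>The code vanishes on the tables, so the translation changes only the address and thereby
  the entry consulted.\<close>

lemma encode_hit:
  "encode g f \<oplus>\<^sub>2 y \<in> hit (Suc (g n)) n (\<lambda>a. {a}) \<longleftrightarrow> y \<in> hit (Suc (g n)) n (\<lambda>a. {flip (f n) a})"
  unfolding hit_def addr_encode mem_Collect_eq by (simp add: cantor_add_def)

text \<open>Translating the null set \<open>F\<close> by the codes yields the sets limsup
  \<open>A n (f n)\<close>, so additivity puts them into one null set. The factor
  \<open>4 ^ n\<close> is Chebyshev's bound for one \<open>K i\<close>, the factor
  \<open>Suc n\<close> counts the \<open>i \<le> n\<close>.\<close>

lemma N_additive_slalom: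
  assumes add: "N_additive (encode g ` Fam)"
  shows "\<exists>S :: nat \<Rightarrow> nat set. (\<forall>n. finite (S n) \<and> card (S n) \<le> Suc n * 4 ^ n) \<and>
    (\<forall>f\<in>Fam. (\<forall>\<^sub>\<infinity>n. f n \<le> g n) \<longrightarrow> (\<forall>\<^sub>\<infinity>n. f n \<in> S n))"
proof -
  define A where "A n k = hit (Suc (g n)) n (\<lambda>a. {flip k a})" for n k
  define F where "F = {y. \<exists>\<^sub>\<infinity>n. y \<in> hit (Suc (g n)) n (\<lambda>a. {a})}"
  have "F \<in> null_sets cantor_measure"
    unfolding F_def
    by (rule limsup_null[where e = "\<lambda>n. (1/2)^n"]) (auto simp: mu_hit[where r = 1] hit_borel)
  then have "F \<in> null_ideal" unfolding null_ideal_iff by blast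
  then have null: "{y \<oplus>\<^sub>2 z | y z. y \<in> encode g ` Fam \<and> z \<in> F} \<in> null_ideal" (is "?N \<in> _")
    using add unfolding N_additive_def by blast
  have opA: "open (A n k)" for n k unfolding A_def by (rule open_hit) simp
  have A: "A n k \<in> sets borel" for n k unfolding A_def by (rule hit_borel)
  have sub: "{y. \<exists>\<^sub>\<infinity>n. y \<in> A n (f n)} \<subseteq> ?N" if "f \<in> Fam" for f
  proof
    fix y assume "y \<in> {y. \<exists>\<^sub>\<infinity>n. y \<in> A n (f n)}"
    then have "encode g f \<oplus>\<^sub>2 y \<in> F" unfolding F_def A_def mem_Collect_eq encode_hit .
    moreover have "y = encode g f \<oplus>\<^sub>2 (encode g f \<oplus>\<^sub>2 y)" unfolding cantor_add_def by (rule ext) blast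
    ultimately show "y \<in> ?N" using that by blast
  qed
  obtain K :: "nat \<Rightarrow> cantor set" where
    K': "(\<forall>i. K i \<in> sets borel \<and> 0 < mu (K i)) \<and>
    (\<forall>h\<in>Fam. \<exists>i. \<forall>\<^sub>\<infinity>n. mu (K i \<inter> A n (h n)) = 0)"
    using limsup_in_null_separation[where A = A and Fam = Fam, OF opA null sub] ..
  have K: "\<And>i. K i \<in> sets borel" "\<And>i. 0 < mu (K i)"
    "\<And>h. h \<in> Fam \<Longrightarrow> \<exists>i. \<forall>\<^sub>\<infinity>n. mu (K i \<inter> A n (h n)) = 0"
    using K' by blast+
  \<comment> \<open>For \<open>k \<le> g n\<close> the flipped positions lie inside the address, so
    different \<open>k\<close> consult different entries and the sets \<open>A n k\<close> are
    independent.\<close>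
  define S where "S i n = {k. k \<le> g n \<and> mu (K i \<inter> A n k) = 0}" for i n
  have finS: "finite (S i n)" for i n unfolding S_def by simp
  have muA: "mu (A n k) = (1/2)^n" for n k
    unfolding A_def by (subst mu_hit[where r = 1]) auto
  have muAA: "mu (A n k \<inter> A n l) = ((1/2)^n)\<^sup>2" if "k \<le> g n" "l \<le> g n" "k \<noteq> l" for n k l
  proof -
    have "A n k \<inter> A n l = hit (Suc (g n)) n (\<lambda>a. {flip k a, flip l a})"
      unfolding A_def hit_def by blast
    also have "mu \<dots> = (1/2) ^ (2 * n)"
      using that by (intro mu_hit) (auto simp: flip_neq)
    finally show ?thesis by (simp only: power_even_eq)
  qed
  have cardS: "mu (K i) * (card (S i n) * (1/2)^n) \<le> 1" for i n
  proof (rule cantor.pairwise_independent_cover[where A = "A n"])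
    show "A n k \<in> cantor.events" for k using A sets_cantor by simp
    show "K i \<in> cantor.events" using K(1) sets_cantor by simp
    show "mu (A n k \<inter> A n l) = ((1/2)^n)\<^sup>2" if "k \<in> S i n" "l \<in> S i n" "k \<noteq> l" for k l
      using that by (intro muAA) (simp_all add: S_def)
    show "mu (K i \<inter> A n k) = 0" if "k \<in> S i n" for k using that unfolding S_def by blast
  qed (rule finS muA)+
  have small: "\<exists>m. \<forall>n\<ge>m. card (S i n) \<le> 4 ^ n" for i
  proof -
    \<comment> \<open>For \<open>n \<ge> m\<close> the bound \<open>2 ^ n / mu (K i)\<close> is at
      most \<open>4 ^ n\<close>.\<close>
    obtain m where m: "(1/2 :: real) ^ m < mu (K i)"
      using real_arch_pow_inv[OF K(2)[of i], of "1/2"] by auto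
    have "card (S i n) \<le> 4 ^ n" if "m \<le> n" for n
    proof -
      have "(1/2 :: real) ^ n \<le> (1/2) ^ m" using that by (intro power_decreasing) auto
      also have "\<dots> \<le> mu (K i)" using m by (rule less_imp_le)
      finally have "(1/2) ^ n * (card (S i n) * (1/2)^n) \<le> mu (K i) * (card (S i n) * (1/2)^n)"
        by (rule mult_right_mono) simp
      also have "\<dots> \<le> 1" by (rule cardS)
      also have "(1/2) ^ n * (card (S i n) * (1/2)^n) = real (card (S i n)) / 4 ^ n"
        by (simp add: power_divide flip: power_mult_distrib)
      finally have "real (card (S i n)) \<le> 4 ^ n" by (simp add: divide_le_eq)
      then show ?thesis by (metis of_nat_le_iff of_nat_numeral of_nat_power)
    qed
    then show ?thesis by blast
  qed
  define T where "T n = (\<Union>i\<in>{i. i \<le> n \<and> card (S i n) \<le> 4 ^ n}. S i n)" for n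
  show ?thesis
  proof (intro exI[of _ T] conjI allI ballI impI)
    show "finite (T n)" for n unfolding T_def using finS by auto
    show "card (T n) \<le> Suc n * 4 ^ n" for n
    proof -
      have "card (T n) \<le> (\<Sum>i\<in>{i. i \<le> n \<and> card (S i n) \<le> 4 ^ n}. card (S i n))"
        unfolding T_def by (intro card_UN_le) simp
      also have "\<dots> \<le> of_nat (card {i. i \<le> n \<and> card (S i n) \<le> 4 ^ n}) * 4 ^ n"
        by (intro sum_bounded_above) simp
      also have "\<dots> \<le> Suc n * 4 ^ n"
      proof -
        have "card {i. i \<le> n \<and> card (S i n) \<le> 4 ^ n} \<le> card {..n}" by (intro card_mono) auto
        then show ?thesis unfolding of_nat_id card_atMost by (rule mult_le_mono1)
      qed
      finally show ?thesis .
    qed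
    fix f assume f: "f \<in> Fam" "\<forall>\<^sub>\<infinity>n. f n \<le> g n"
    obtain i where i: "\<forall>\<^sub>\<infinity>n. mu (K i \<inter> A n (f n)) = 0" using K(3)[OF f(1)] by blast
    obtain m where m: "\<And>n. m \<le> n \<Longrightarrow> card (S i n) \<le> 4 ^ n" using small by blast
    have "\<forall>\<^sub>\<infinity>n. max i m \<le> n" unfolding MOST_nat_le by blast
    with i f(2) have "\<forall>\<^sub>\<infinity>n. mu (K i \<inter> A n (f n)) = 0 \<and> f n \<le> g n \<and> max i m \<le> n"
      by (intro eventually_conj)
    then show "\<forall>\<^sub>\<infinity>n. f n \<in> T n"
    proof (rule eventually_mono)
      fix n assume n: "mu (K i \<inter> A n (f n)) = 0 \<and> f n \<le> g n \<and> max i m \<le> n"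
      then have "f n \<in> S i n" unfolding S_def by blast
      moreover have "i \<le> n" "card (S i n) \<le> 4 ^ n" using n m by simp_all
      ultimately show "f n \<in> T n" unfolding T_def by blast
    qed
  qed
qed

section \<open>Covering the sections by clopen sets\<close>

lemma same_point_cyl_subset:
  assumes "y \<in> cyl s" "y \<in> cyl t" "length t \<le> length s"
  shows "cyl s \<subseteq> cyl t"
  using assms cyl_prefix_antimono[OF assms(3), of y] by (metis mem_cyl_iff)

text \<open>
  Keeping only the minimal words makes the cylinders disjoint, so that their measures sum up to the
  measure of the section.
\<close>

definition minimal_code :: "(bool list \<Rightarrow> cantor set) \<Rightarrow> bool list \<Rightarrow> cantor set" where
  "minimal_code A s = A s - (\<Union>t\<in>{t. length t < length s \<and> cyl s \<subseteq> cyl t}. A t)"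

lemma minimal_code_borel: "(\<And>s. A s \<in> sets borel) \<Longrightarrow> minimal_code A s \<in> sets borel"
  unfolding minimal_code_def by (intro sets.Diff sets.countable_UN') auto

text \<open>A shortest word among those covering \<open>(x, y)\<close> is never discarded.\<close>

lemma minimal_code_covers:
  assumes "(x, y) \<in> coded A"
  obtains s where "x \<in> minimal_code A s" "y \<in> cyl s"
proof -
  define P where "P s \<longleftrightarrow> x \<in> A s \<and> y \<in> cyl s" for s
  obtain s0 where "P s0" using assms unfolding coded_def P_def by blast
  define s where "s = arg_min length P"
  have s: "P s" and min: "\<And>t. P t \<Longrightarrow> length s \<le> length t"
    using arg_min_nat_lemma[of P s0 length] \<open>P s0\<close> by (auto simp: s_def)
  have "x \<notin> A t" if "length t < length s" "cyl s \<subseteq> cyl t" for t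
    using min[of t] that s unfolding P_def by auto
  then have "x \<in> minimal_code A s" using s unfolding minimal_code_def P_def by blast
  then show thesis using that s unfolding P_def by blast
qed

text \<open>Cylinders with a common point are nested, so the shorter word discards the longer; equal
  lengths give equal words.\<close>

lemma minimal_code_disjoint:
  assumes "x \<in> minimal_code A s" "x \<in> minimal_code A t" "s \<noteq> t"
  shows "cyl s \<inter> cyl t = {}"
proof -
  have less: False if "x \<in> minimal_code A s" "x \<in> minimal_code A t" "length t < length s" "y \<in> cyl s" "y \<in> cyl t" for s t y
    using that same_point_cyl_subset[of y s t] unfolding minimal_code_def by auto
  have "False" if y: "y \<in> cyl s" "y \<in> cyl t" for y
  proof (cases "length s" "length t" rule: linorder_cases)
    case equal
    then show False using y assms(3) by (metis mem_cyl_iff)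
  qed (use less assms y in blast)+
  then show ?thesis by blast
qed

lemma minimal_code_sum:
  assumes A: "\<And>s. A s \<in> sets borel" and P: "finite P" "\<And>s. s \<in> P \<Longrightarrow> x \<in> minimal_code A s"
  shows "(\<Sum>s\<in>P. (1/2) ^ length s) \<le> mu (section_at (coded A) x)"
proof -
  have "(\<Sum>s\<in>P. (1/2) ^ length s) = (\<Sum>s\<in>P. mu (cyl s))" by (simp only: mu_cyl)
  also have "\<dots> = mu (\<Union>s\<in>P. cyl s)"
  proof (rule cantor.finite_measure_finite_Union[symmetric])
    show "disjoint_family_on cyl P"
      unfolding disjoint_family_on_def using minimal_code_disjoint P(2) by blast
    show "cyl ` P \<subseteq> cantor.events" using cyl_borel unfolding sets_cantor by blast
  qed (rule P)
  also have "\<dots> \<le> mu (section_at (coded A) x)"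
  proof (rule cantor.finite_measure_mono)
    show "(\<Union>s\<in>P. cyl s) \<subseteq> section_at (coded A) x"
      using P(2) unfolding section_at_def coded_def minimal_code_def by blast
    show "section_at (coded A) x \<in> cantor.events" using coded_borel[of A] A by simp
  qed
  finally show ?thesis .
qed

text \<open>For each \<open>m\<close> the section is covered by disjoint cylinders of total measure
  at most \<open>(1/2) ^ m\<close>. Listing all pairs \<open>(m, s)\<close> gives a summable
  sequence that catches every point once for each \<open>m\<close>, hence infinitely often.\<close>

lemma null_sections_cover:
  assumes H: "H \<in> sets borel" "\<And>x. section_at H x \<in> null_ideal"
  shows "\<exists>(c :: nat \<Rightarrow> bool list) (R :: nat \<Rightarrow> cantor set). (\<forall>j. R j \<in> sets borel) \<and>
    (\<forall>x. summable (\<lambda>j. indicator (R j) x * (1/2 :: real) ^ length (c j))) \<and>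
    (\<forall>x y. (x, y) \<in> H \<longrightarrow> (\<exists>\<^sub>\<infinity>j. x \<in> R j \<and> y \<in> cyl (c j)))"
proof -
  have H0: "mu (section_at H x) = 0" for x
  proof -
    obtain N where N: "N \<in> null_sets cantor_measure" "section_at H x \<subseteq> N"
      using H(2)[of x] null_ideal_iff by blast
    then have "mu (section_at H x) \<le> mu N" by (intro cantor.finite_measure_mono) (auto simp: null_sets_def)
    also have "mu N = 0" using N(1) by (simp add: null_sets_def measure_def)
    finally show ?thesis using measure_nonneg[of cantor_measure "section_at H x"] by simp
  qed
  obtain A where A: "\<And>m s. A m s \<in> sets borel" "\<And>m. H \<subseteq> coded (A m)"
     "\<And>m x. mu (section_at (coded (A m)) x) \<le> mu (section_at H x) + (1/2) ^ m"
    by (rule outer_approx_seqE[where H = "\<lambda>_. H" and e = "\<lambda>m. (1/2) ^ m"])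
      (use outer_approx_borel[OF H(1)] in simp, simp, rule that)
  let ?p = "from_nat :: nat \<Rightarrow> nat \<times> bool list"
  define c where "c j = snd (?p j)" for j
  \<comment> \<open>The test \<open>to_nat (?p j) = j\<close> keeps one index for each pair, since
    \<open>from_nat\<close> may repeat values.\<close>
  define R where "R j = (if to_nat (?p j) = j then minimal_code (A (fst (?p j))) (snd (?p j)) else {})" for j
  have R: "R j \<in> sets borel" for j unfolding R_def using minimal_code_borel A(1) by simp
  have summ: "summable (\<lambda>j. indicator (R j) x * (1/2 :: real) ^ length (c j))" for x
  proof (rule summableI_nonneg_bounded)
    fix N
    define J where "J = {j. j < N \<and> x \<in> R j}"
    define Q where "Q = ?p ` J"
    have J: "finite J" unfolding J_def by simp
    then have Q: "finite Q" unfolding Q_def by simp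
    have inj: "inj_on ?p J" 
    proof (rule inj_on_inverseI[where g = to_nat])
      fix j assume "j \<in> J"
      then have "x \<in> R j" unfolding J_def by blast
      then show "to_nat (?p j) = j" unfolding R_def by (auto split: if_splits)
    qed
    have mem: "x \<in> minimal_code (A m) s" if ms: "(m, s) \<in> Q" for m s
    proof -
      obtain j where j: "j \<in> J" "(m, s) = ?p j" using ms unfolding Q_def by blast
      then have "x \<in> R j" unfolding J_def by blast
      then show ?thesis unfolding R_def j(2)[symmetric] by (auto split: if_splits)
    qed
    have "(\<Sum>j<N. indicator (R j) x * (1/2 :: real) ^ length (c j)) = (\<Sum>j\<in>J. (1/2) ^ length (snd (?p j)))"
      by (rule sum.mono_neutral_cong_right) (auto simp: J_def c_def)
    also have "\<dots> = (\<Sum>q\<in>Q. (1/2) ^ length (snd q))"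
      unfolding Q_def by (simp add: sum.reindex[OF inj])
    \<comment> \<open>Grouping by \<open>m\<close> reduces the estimate to one cover at a
      time.\<close>
    also have "\<dots> = (\<Sum>q\<in>(SIGMA m:fst ` Q. {s. (m, s) \<in> Q}). (1/2) ^ length (snd q))"
      by (rule sum.cong) force+
    also have "\<dots> = (\<Sum>m\<in>fst ` Q. \<Sum>s\<in>{s. (m, s) \<in> Q}. (1/2) ^ length s)"
    proof -
      have "finite {s. (m, s) \<in> Q}" for m
        by (rule finite_subset[of _ "snd ` Q"]) (use Q in force)+
      then show ?thesis using Q by (simp add: sum.Sigma case_prod_unfold)
    qed
    also have "\<dots> \<le> (\<Sum>m\<in>fst ` Q. (1/2) ^ m)"
    proof (rule sum_mono)
      fix m
      have "finite {s. (m, s) \<in> Q}"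
        by (rule finite_subset[of _ "snd ` Q"]) (use Q in force)+
      then have "(\<Sum>s\<in>{s. (m, s) \<in> Q}. (1/2) ^ length s) \<le> mu (section_at (coded (A m)) x)"
        by (rule minimal_code_sum[OF A(1)]) (use mem in blast)
      also have "\<dots> \<le> (1/2) ^ m" using A(3)[of m x] H0 by simp
      finally show "(\<Sum>s\<in>{s. (m, s) \<in> Q}. (1/2) ^ length s) \<le> (1/2 :: real) ^ m" .
    qed
    also have "\<dots> \<le> (\<Sum>m. (1/2) ^ m)"
      using Q by (intro sum_le_suminf summable_geometric) auto
    finally show "(\<Sum>j<N. indicator (R j) x * (1/2 :: real) ^ length (c j)) \<le> (\<Sum>m. (1/2) ^ m)" .
  qed simp
  have cover: "\<exists>\<^sub>\<infinity>j. x \<in> R j \<and> y \<in> cyl (c j)" if xy: "(x, y) \<in> H" for x y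
  proof -
    have "\<exists>s. x \<in> minimal_code (A m) s \<and> y \<in> cyl s" for m
      using A(2)[of m] xy by (meson minimal_code_covers subsetD)
    then obtain s where s: "\<And>m. x \<in> minimal_code (A m) (s m) \<and> y \<in> cyl (s m)" by metis
    define J where "J m = to_nat (m, s m)" for m
    have "inj J" unfolding J_def by (rule injI) simp
    then have "infinite (range J)" by (rule range_inj_infinite)
    moreover have "range J \<subseteq> {j. x \<in> R j \<and> y \<in> cyl (c j)}"
      using s by (auto simp: J_def R_def c_def)
    ultimately show ?thesis unfolding INFM_iff_infinite by (rule infinite_super[rotated])
  qed
  show ?thesis using R summ cover by (intro exI[of _ c] exI[of _ R] conjI allI impI)
qed

text \<open>The indices are cut at points \<open>k n x\<close> beyond which the remaining weight is
  below \<open>(1/8) ^ n\<close>; \<open>f x n\<close> codes the finite set of relevant indices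
  between two successive cuts.\<close>

lemma block_cover:
  fixes c :: "nat \<Rightarrow> bool list" and R :: "nat \<Rightarrow> cantor set"
  assumes R: "\<And>j. R j \<in> sets borel"
    and summ: "\<And>x. summable (\<lambda>j. indicator (R j) x * (1/2 :: real) ^ length (c j))"
  shows "\<exists>f :: cantor \<Rightarrow> nat \<Rightarrow> nat. f \<in> borel_measurable borel \<and>
    (\<forall>x n. (\<Sum>j\<in>set_decode (f x n). (1/2 :: real) ^ length (c j)) \<le> (1/8) ^ n) \<and>
    (\<forall>x y. (\<exists>\<^sub>\<infinity>j. x \<in> R j \<and> y \<in> cyl (c j)) \<longrightarrow>
      (\<exists>\<^sub>\<infinity>n. \<exists>j\<in>set_decode (f x n). y \<in> cyl (c j)))"
proof -
  define w where "w j x = indicator (R j) x * (1/2 :: real) ^ length (c j)" for j x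
  have w0: "0 \<le> w j x" for j x by (simp add: w_def)
  have ws: "summable (\<lambda>j. w j x)" for x unfolding w_def by (rule summ)
  have w_meas [measurable]: "w j \<in> borel_measurable borel" for j
    unfolding w_def using R by (intro borel_measurable_times borel_measurable_indicator borel_measurable_const)
  define tail where "tail k x = (\<Sum>j. w (j + k) x)" for k x
  have tail_meas [measurable]: "tail k \<in> borel_measurable borel" for k
    unfolding tail_def by measurable
  \<comment> \<open>The clause \<open>n \<le> k\<close> sends the cuts to infinity, so every index
    past the first cut falls into some block.\<close>
  define P where "P n k x \<longleftrightarrow> n \<le> k \<and> tail k x < (1/8) ^ n" for n k x
  define k where "k n x = (LEAST m. P n m x)" for n x
  have P_meas [measurable]: "Measurable.pred borel (P n m)" for n m unfolding P_def by measurable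
  have k_meas [measurable]: "k n \<in> measurable borel (count_space UNIV)" for n unfolding k_def by measurable
  have exP: "\<exists>m. P n m x" for n x
  proof -
    have "(\<lambda>m. tail m x) \<longlonglongrightarrow> 0" unfolding tail_def by (rule suminf_exist_split2[OF ws])
    then have "\<forall>\<^sub>F m in sequentially. tail m x < (1/8) ^ n" by (rule order_tendstoD) simp
    then have "\<forall>\<^sub>F m in sequentially. n \<le> m \<and> tail m x < (1/8) ^ n"
      using eventually_ge_at_top[of n] by (rule eventually_conj[rotated])
    then show ?thesis unfolding P_def by (rule eventually_happens'[OF sequentially_bot])
  qed
  have Pk: "P n (k n x) x" for n x unfolding k_def using exP by (rule LeastI_ex)
  define Q where "Q n x = {j. k n x \<le> j \<and> j < k (Suc n) x \<and> x \<in> R j}" for n x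
  have finQ: "finite (Q n x)" for n x unfolding Q_def by simp
  define f where "f x n = set_encode (Q n x)" for x n
  have dec: "set_decode (f x n) = Q n x" for x n unfolding f_def using finQ by (rule set_encode_inverse)
  have f_meas: "f \<in> borel_measurable borel"
  proof (rule measurable_coordinatewise_then_product)
    fix n
    \<comment> \<open>With the upper cut frozen at \<open>K\<close>, the code is a fixed finite sum;
      the cut takes countably many values.\<close>
    define F where "F K x = (\<Sum>j<K. if k n x \<le> j \<and> x \<in> R j then 2 ^ j else 0 :: nat)" for K x
    have "f x n = F (k (Suc n) x) x" for x
    proof -
      have "(\<Sum>j\<in>Q n x. 2 ^ j) = (\<Sum>j<k (Suc n) x. if k n x \<le> j \<and> x \<in> R j then 2 ^ j else 0 :: nat)"
        by (rule sum.mono_neutral_cong_left) (auto simp: Q_def)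
      then show ?thesis by (simp add: f_def set_encode_def F_def)
    qed
    moreover have "(\<lambda>x. F (k (Suc n) x) x) \<in> borel_measurable borel"
    proof (rule measurable_compose_countable[OF _ k_meas])
      fix K
      have [measurable]: "R j \<in> sets borel" for j by (rule R)
      show "F K \<in> borel_measurable borel" unfolding F_def by measurable
    qed
    ultimately show "(\<lambda>x. f x n) \<in> borel_measurable borel" by simp
  qed
  have wt: "(\<Sum>j\<in>set_decode (f x n). (1/2 :: real) ^ length (c j)) \<le> (1/8) ^ n" for x n
  proof -
    define B where "B = (\<lambda>j. j - k n x) ` Q n x"
    have inj: "inj_on (\<lambda>j. j - k n x) (Q n x)" by (rule inj_onI) (auto simp: Q_def)
    have "(\<Sum>j\<in>Q n x. (1/2 :: real) ^ length (c j)) = (\<Sum>j\<in>Q n x. w (j - k n x + k n x) x)"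
      by (rule sum.cong) (auto simp: Q_def w_def)
    also have "\<dots> = (\<Sum>i\<in>B. w (i + k n x) x)" unfolding B_def by (simp add: sum.reindex[OF inj])
    also have "\<dots> \<le> tail (k n x) x"
      unfolding tail_def
    proof (rule sum_le_suminf)
      show "summable (\<lambda>i. w (i + k n x) x)" using ws by (rule summable_ignore_initial_segment)
    qed (use finQ w0 in \<open>auto simp: B_def\<close>)
    also have "\<dots> \<le> (1/8) ^ n" using Pk[of n x] unfolding P_def by simp
    finally show ?thesis unfolding dec .
  qed
  have cov: "\<exists>\<^sub>\<infinity>n. \<exists>j\<in>set_decode (f x n). y \<in> cyl (c j)"
    if inf: "\<exists>\<^sub>\<infinity>j. x \<in> R j \<and> y \<in> cyl (c j)" for x y
    unfolding INFM_nat_le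
  proof
    fix n0
    obtain j where j: "k n0 x \<le> j" "x \<in> R j" "y \<in> cyl (c j)" using inf unfolding INFM_nat_le by blast
    \<comment> \<open>The last cut not beyond \<open>j\<close>; it exists because
      \<open>m \<le> k m x\<close>, and the next cut lies beyond \<open>j\<close>.\<close>
    define n where "n = (GREATEST n. k n x \<le> j)"
    have bound: "m \<le> j" if "k m x \<le> j" for m using that Pk[of m x] unfolding P_def by simp
    have n: "k n x \<le> j" unfolding n_def using j(1) bound by (rule GreatestI_nat)
    have n0: "n0 \<le> n" unfolding n_def using j(1) bound by (rule Greatest_le_nat)
    have "\<not> k (Suc n) x \<le> j"
    proof
      assume "k (Suc n) x \<le> j"
      then have "Suc n \<le> n" unfolding n_def using bound by (rule Greatest_le_nat)
      then show False by simp
    qed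
    then have "j \<in> set_decode (f x n)" unfolding dec Q_def using n j(2) by simp
    then show "\<exists>n\<ge>n0. \<exists>j\<in>set_decode (f x n). y \<in> cyl (c j)" using n0 j(3) by blast
  qed
  show ?thesis using f_meas wt cov by (intro exI[of _ f] conjI allI impI)
qed

section \<open>From slaloms to the SR property\<close>

lemma encode_measurable:
  assumes f: "f \<in> borel_measurable M"
  shows "(\<lambda>x. encode g (f x)) \<in> borel_measurable M"
proof (rule measurable_coordinatewise_then_product)
  fix i
  have [measurable]: "Measurable.pred M (\<lambda>x. P (f x n))" for P :: "nat \<Rightarrow> bool" and n
  proof -
    have "P \<in> borel_measurable borel" 
      by (intro borel_measurable_continuous_onI) simp
    with measurable_borel_coord[OF f, of n] have "(\<lambda>x. P (f x n)) \<in> borel_measurable M"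
      by (rule measurable_compose)
    then show ?thesis by (simp only: borel_measurable_bool_iff)
  qed
  have "Measurable.pred M (\<lambda>x. encode g (f x) i)" unfolding encode_def by measurable
  then show "(\<lambda>x. encode g (f x) i) \<in> borel_measurable M" by (simp only: borel_measurable_bool_iff)
qed

text \<open>Stage \<open>n\<close> has measure at most
  \<open>Suc n * 4 ^ n * (1/8) ^ n = Suc n * (1/2) ^ n\<close>, which is summable.\<close>

lemma slalom_limsup_null:
  fixes c :: "nat \<Rightarrow> bool list"
  assumes S: "\<And>n. finite (S n)" "\<And>n. card (S n) \<le> Suc n * 4 ^ n"
    and C: "\<And>n v. v \<in> S n \<Longrightarrow> (\<Sum>j\<in>set_decode v. (1/2 :: real) ^ length (c j)) \<le> (1/8) ^ n"
  shows "{y. \<exists>\<^sub>\<infinity>n. \<exists>v\<in>S n. \<exists>j\<in>set_decode v. y \<in> cyl (c j)} \<in> null_sets cantor_measure"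
proof -
  define E where "E n = (\<Union>v\<in>S n. \<Union>j\<in>set_decode v. cyl (c j))" for n
  have "{y. \<exists>\<^sub>\<infinity>n. y \<in> E n} \<in> null_sets cantor_measure"
  proof (rule limsup_null)
    have C_borel: "(\<Union>j\<in>set_decode v. cyl (c j)) \<in> sets borel" for v
      by (intro sets.countable_UN' cyl_borel) auto
    show "E n \<in> sets borel" for n
      unfolding E_def using C_borel by (intro sets.countable_UN') auto
    show "mu (E n) \<le> real (Suc n) * (1/2) ^ n" for n
    proof -
      have "mu (E n) \<le> (\<Sum>v\<in>S n. mu (\<Union>j\<in>set_decode v. cyl (c j)))"
        unfolding E_def using C_borel S(1) unfolding sets_cantor[symmetric]
        by (intro cantor.finite_measure_subadditive_finite) auto
      also have "\<dots> \<le> (\<Sum>v\<in>S n. (1/8) ^ n)"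
      proof (rule sum_mono)
        fix v assume v: "v \<in> S n"
        have "mu (\<Union>j\<in>set_decode v. cyl (c j)) \<le> (\<Sum>j\<in>set_decode v. mu (cyl (c j)))"
          using cyl_borel unfolding sets_cantor[symmetric]
          by (intro cantor.finite_measure_subadditive_finite) auto
        also have "\<dots> \<le> (1/8) ^ n" using C[OF v] by (simp only: mu_cyl)
        finally show "mu (\<Union>j\<in>set_decode v. cyl (c j)) \<le> (1/8) ^ n" .
      qed
      also have "\<dots> = real (card (S n)) * (1/8) ^ n" by simp
      also have "\<dots> \<le> real (Suc n * 4 ^ n) * (1/8) ^ n"
        using S(2)[of n] by (intro mult_right_mono of_nat_mono) auto
      also have "\<dots> = real (Suc n) * (4 * (1/8)) ^ n"
        by (simp only: of_nat_mult of_nat_power of_nat_numeral power_mult_distrib mult.assoc)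
      also have "\<dots> = real (Suc n) * (1/2) ^ n" by simp
      finally show ?thesis .
    qed
    show "summable (\<lambda>n. real (Suc n) * (1/2) ^ n)"
      using geometric_deriv_sums[of "1/2 :: real"] by (auto simp: sums_iff)
  qed
  then show ?thesis by (simp add: E_def)
qed

text \<open>Boundedness provides a \<open>g\<close> such that \<open>encode g\<close> records almost
  all values of each \<open>f x\<close>; additivity for the encoded image then provides the
  slalom.\<close>

lemma additive_bounded_imp_SR_N:
  assumes add: "\<And>Y :: cantor set. borel_image X Y \<Longrightarrow> N_additive Y"
    and bdd: "\<And>F :: (nat \<Rightarrow> nat) set. borel_image X F \<Longrightarrow> eventually_bounded F"
  shows "SR_N X"
  unfolding SR_N_def
proof (intro allI impI)
  fix H assume "N_set H"
  then have H: "H \<in> sets borel" "\<And>x. section_at H x \<in> null_ideal" by (auto simp: N_set_def)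
  obtain c :: "nat \<Rightarrow> bool list" and R :: "nat \<Rightarrow> cantor set" where R:
    "\<forall>j. R j \<in> sets borel"
    "\<forall>x. summable (\<lambda>j. indicator (R j) x * (1/2 :: real) ^ length (c j))"
    "\<forall>x y. (x, y) \<in> H \<longrightarrow> (\<exists>\<^sub>\<infinity>j. x \<in> R j \<and> y \<in> cyl (c j))"
    using null_sections_cover[OF H] by (elim exE conjE)
  obtain f :: "cantor \<Rightarrow> nat \<Rightarrow> nat" where f: "f \<in> borel_measurable borel"
    "\<forall>x n. (\<Sum>j\<in>set_decode (f x n). (1/2 :: real) ^ length (c j)) \<le> (1/8) ^ n"
    "\<forall>x y. (\<exists>\<^sub>\<infinity>j. x \<in> R j \<and> y \<in> cyl (c j)) \<longrightarrow> (\<exists>\<^sub>\<infinity>n. \<exists>j\<in>set_decode (f x n). y \<in> cyl (c j))"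
    using block_cover[OF R(1,2)[rule_format]] by (elim exE conjE)
  have fX: "f \<in> borel_measurable (restrict_space borel X)" using f(1) by (rule measurable_restrict_space1)
  then have "borel_image X (f ` X)" unfolding borel_image_def by blast
  then obtain g where g: "\<And>h. h \<in> f ` X \<Longrightarrow> \<forall>\<^sub>F n in sequentially. h n \<le> g n"
    using bdd unfolding eventually_bounded_def by blast
  have "borel_image X (encode g ` f ` X)"
    unfolding borel_image_def image_image using encode_measurable[OF fX] by blast
  then have "N_additive (encode g ` f ` X)" by (rule add)
  then obtain S :: "nat \<Rightarrow> nat set" where S: "\<forall>n. finite (S n) \<and> card (S n) \<le> Suc n * 4 ^ n"
    "\<forall>h\<in>f ` X. (\<forall>\<^sub>\<infinity>n. h n \<le> g n) \<longrightarrow> (\<forall>\<^sub>\<infinity>n. h n \<in> S n)"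
    using N_additive_slalom by blast
  \<comment> \<open>The slalom may contain numbers coding large sets; discarding them keeps all
    values \<open>f x n\<close> that it captures.\<close>
  define T where "T n = {v \<in> S n. (\<Sum>j\<in>set_decode v. (1/2 :: real) ^ length (c j)) \<le> (1/8) ^ n}" for n
  have T: "finite (T n)" "card (T n) \<le> Suc n * 4 ^ n" for n
  proof -
    have sub: "T n \<subseteq> S n" and fin: "finite (S n)" unfolding T_def using S(1) by blast+
    show "finite (T n)" using sub fin by (rule finite_subset)
    have "card (T n) \<le> card (S n)" using fin sub by (rule card_mono)
    also have "\<dots> \<le> Suc n * 4 ^ n" using S(1) by blast
    finally show "card (T n) \<le> Suc n * 4 ^ n" .
  qed
  then have null: "{y. \<exists>\<^sub>\<infinity>n. \<exists>v\<in>T n. \<exists>j\<in>set_decode v. y \<in> cyl (c j)} \<in> null_sets cantor_measure"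
    by (rule slalom_limsup_null) (simp add: T_def)
  have "(\<Union>x\<in>X. section_at H x) \<subseteq> {y. \<exists>\<^sub>\<infinity>n. \<exists>v\<in>T n. \<exists>j\<in>set_decode v. y \<in> cyl (c j)}"
  proof safe
    fix x y assume x: "x \<in> X" and "y \<in> section_at H x"
    then have "(x, y) \<in> H" by (simp add: section_at_def)
    then have "\<exists>\<^sub>\<infinity>n. \<exists>j\<in>set_decode (f x n). y \<in> cyl (c j)" using R(3) f(3) by blast
    moreover have "\<forall>\<^sub>\<infinity>n. f x n \<in> S n"
      using S(2) g[of "f x"] x unfolding cofinite_eq_sequentially by blast
    ultimately have "\<exists>\<^sub>\<infinity>n. (\<exists>j\<in>set_decode (f x n). y \<in> cyl (c j)) \<and> f x n \<in> S n"
      by (rule INFM_conjI)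
    then show "\<exists>\<^sub>\<infinity>n. \<exists>v\<in>T n. \<exists>j\<in>set_decode v. y \<in> cyl (c j)"
    proof (rule INFM_mono)
      fix n assume n: "(\<exists>j\<in>set_decode (f x n). y \<in> cyl (c j)) \<and> f x n \<in> S n"
      then have "f x n \<in> T n" unfolding T_def using f(2) by blast
      then show "\<exists>v\<in>T n. \<exists>j\<in>set_decode v. y \<in> cyl (c j)" using n by blast
    qed
  qed
  then show "(\<Union>x\<in>X. section_at H x) \<in> null_ideal" unfolding null_ideal_iff using null by blast
qed

theorem theorem3p7:
  fixes X :: "cantor set"
  shows "SR_N X \<longleftrightarrow>
    (\<forall>Y :: cantor set. borel_image X Y \<longrightarrow> N_additive Y) \<and>
    (\<forall>F :: (nat \<Rightarrow> nat) set. borel_image X F \<longrightarrow> eventually_bounded F)"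
  using SR_N_imp_additive SR_N_imp_bounded additive_bounded_imp_SR_N by blast

end
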